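(* Let $\boldsymbol F=(F^1,\dots,F^n)\in\mathbb C[[t^1,\dots,t^n]]^{n}$ be a quasi-homogeneous solution of the oriented associativity equations. If $\boldsymbol F$ defines a semisimple formal flat $F$-manifold which is not strictly doubly resonant, then $\boldsymbol F$ is a tuple of convergent functions: the power series $F^1,\dots,F^n$ converge on a common neighbourhood of $\boldsymbol t=0$.
   Context: Oriented associativity equations, for constants $A^\mu\in\mathbb C$: $\sum_\mu A^\mu\frac{\partial^2F^\alpha}{\partial t^\mu\partial t^\beta}=\delta^\alpha_\beta$ and $\sum_\mu\frac{\partial^2F^\alpha}{\partial t^\mu\partial t^\beta}\frac{\partial^2F^\mu}{\partial t^\gamma\partial t^\varepsilon}=\sum_\mu\frac{\partial^2F^\alpha}{\partial t^\mu\partial t^\gamma}\frac{\partial^2F^\mu}{\partial t^\beta\partial t^\varepsilon}$ for all $\alpha,\beta,\gamma,\varepsilon$. Quasi-homogeneity: there are $q_\alpha,r^\alpha\in\mathbb C$ such that, for $E=\sum_\alpha((1-q_\alpha)t^\alpha+r^\alpha)\frac{\partial}{\partial t^\alpha}$ (Euler vector field), $EF^\beta=(2-q_\beta)F^\beta+$ (polynomial of degree at most $1$ in $\boldsymbol t$) for all $\beta$. The formal flat $F$-manifold defined by $\boldsymbol F$ has product $\frac{\partial}{\partial t^\beta}\circ\frac{\partial}{\partial t^\gamma}=\sum_\alpha\frac{\partial^2F^\alpha}{\partial t^\beta\partial t^\gamma}\frac{\partial}{\partial t^\alpha}$ and unit $e=\sum_\mu A^\mu\frac{\partial}{\partial t^\mu}$.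 Let $\circ_0$ be the product on $\mathbb C^n=\bigoplus_\alpha\mathbb C\frac{\partial}{\partial t^\alpha}$ obtained by setting $\boldsymbol t=0$. It is semisimple if $(\mathbb C^n,\circ_0)\cong\mathbb C^n$ as algebras, i.e. there is a basis of idempotents $\pi_1,\dots,\pi_n$ with $\pi_i\circ_0\pi_j=\delta_{ij}\pi_i$. In that case define $u^i_o\in\mathbb C$ by $E|_{\boldsymbol t=0}\circ_0\pi_i=u^i_o\pi_i$, and the conformal dimensions $\delta_i\in\mathbb C$ by $\mu^0(\pi_i)\circ_0\pi_i=\delta_i\pi_i$, where $\mu^0(\frac{\partial}{\partial t^\alpha})=q_\alpha\frac{\partial}{\partial t^\alpha}$. The formal flat $F$-manifold is strictly doubly resonant if there are $i\neq j$ with $u^i_o=u^j_o$ and $\delta_i-\delta_j\in\mathbb Z\setminus\{0\}$. *)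

theory Defs
  imports "HOL-Analysis.Analysis"
begin

subsection \<open>Formal power series in finitely many variables\<close>

text \<open>The variables are indexed by the finite type \<open>'n\<close>, and multi-indices are elements of
  \<open>nat ^ 'n\<close>.\<close>

typedef ('a, 'n) mfps = "UNIV :: (nat ^ 'n \<Rightarrow> 'a) set"
  morphisms mfps_nth Abs_mfps
  by simp

setup_lifting type_definition_mfps

lemma mfps_eqI: "(\<And>m. mfps_nth f m = mfps_nth g m) \<Longrightarrow> f = g"
  by (transfer, rule ext, simp)

lemma finite_multiindex_decomp:
  fixes m :: "nat ^ 'n::finite"
  shows "finite {(k, l). k + l = m}"
proof -
  define B where "B = (vec_lambda ` (Pi\<^sub>E UNIV (\<lambda>i. {..m $ i})) :: (nat ^ 'n) set)"
  have "finite B"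
    unfolding B_def by (intro finite_imageI finite_PiE) auto
  have *: "k \<in> B" if "\<And>i. k $ i \<le> m $ i" for k
    unfolding B_def using that
    by (intro image_eqI[of _ _ "vec_nth k"]) (auto simp: vec_nth_inverse PiE_UNIV_domain)
  have "{(k, l). k + l = m} \<subseteq> B \<times> B"
    by (auto intro!: *)
  with \<open>finite B\<close> show ?thesis
    by (meson finite_SigmaI finite_subset)
qed

instantiation mfps :: (comm_ring_1, finite) comm_ring_1
begin

lift_definition zero_mfps :: "('a, 'b) mfps" is "\<lambda>_. 0" .

lift_definition one_mfps :: "('a, 'b) mfps" is "\<lambda>m. if m = 0 then 1 else 0" .

lift_definition plus_mfps :: "('a, 'b) mfps \<Rightarrow> ('a, 'b) mfps \<Rightarrow> ('a, 'b) mfps"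
  is "\<lambda>f g m. f m + g m" .

lift_definition minus_mfps :: "('a, 'b) mfps \<Rightarrow> ('a, 'b) mfps \<Rightarrow> ('a, 'b) mfps"
  is "\<lambda>f g m. f m - g m" .

lift_definition uminus_mfps :: "('a, 'b) mfps \<Rightarrow> ('a, 'b) mfps"
  is "\<lambda>f m. - f m" .

lift_definition times_mfps :: "('a, 'b) mfps \<Rightarrow> ('a, 'b) mfps \<Rightarrow> ('a, 'b) mfps"
  is "\<lambda>f g m. \<Sum>(k, l) \<in> {(k, l). k + l = m}. f k * g l" .

instance
proof
  fix f g h :: "('a, 'b) mfps"
  show "f + g + h = f + (g + h)" by (transfer, simp add: add.assoc)
  show "f + g = g + f" by (transfer, simp add: add.commute)
  show "0 + f = f" by (transfer, simp)
  show "- f + f = 0" by (transfer, simp)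
  show "f - g = f + - g" by (transfer, simp)
  show "(0 :: ('a, 'b) mfps) \<noteq> 1"
    by (transfer, auto simp: fun_eq_iff intro!: exI[of _ 0])
  show "f * g = g * f"
  proof (transfer, rule ext)
    fix f g :: "nat ^ 'b \<Rightarrow> 'a" and m
    show "(\<Sum>(k, l) \<in> {(k, l). k + l = m}. f k * g l) = (\<Sum>(k, l) \<in> {(k, l). k + l = m}. g k * f l)"
      by (rule sum.reindex_bij_witness[of _ prod.swap prod.swap])
         (auto simp: add.commute mult.commute)
  qed
  show "1 * f = f"
  proof (transfer, rule ext)
    fix f :: "nat ^ 'b \<Rightarrow> 'a" and m
    have "(\<Sum>(k, l) \<in> {(k, l). k + l = m}. (if k = 0 then 1 else 0) * f l)
        = (\<Sum>(k, l) \<in> {(0 :: nat ^ 'b, m)}. (if k = 0 then 1 else 0) * f l)"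
      by (rule sum.mono_neutral_right) (auto simp: finite_multiindex_decomp split: if_splits)
    thus "(\<Sum>(k, l) \<in> {(k, l). k + l = m}. (if k = 0 then 1 else 0) * f l) = f m"
      by simp
  qed
  show "(f + g) * h = f * h + g * h"
    by (transfer, simp add: distrib_right sum.distrib case_prod_unfold)
  show "f * g * h = f * (g * h)"
  proof (transfer, rule ext)
    fix f g h :: "nat ^ 'b \<Rightarrow> 'a" and m
    let ?D = "\<lambda>m :: nat ^ 'b. {(k, l). k + l = m}"
    have "(\<Sum>(k, l) \<in> ?D m. (\<Sum>(a, b) \<in> ?D k. f a * g b) * h l)
        = (\<Sum>p \<in> ?D m. \<Sum>s \<in> ?D (fst p). f (fst s) * g (snd s) * h (snd p))"
      by (simp add: case_prod_unfold sum_distrib_right)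
    also have "\<dots> = (\<Sum>(p, s) \<in> Sigma (?D m) (\<lambda>p. ?D (fst p)). f (fst s) * g (snd s) * h (snd p))"
      by (rule sum.Sigma) (auto simp: finite_multiindex_decomp)
    also have "\<dots> = (\<Sum>(p, s) \<in> Sigma (?D m) (\<lambda>p. ?D (snd p)). f (fst p) * (g (fst s) * h (snd s)))"
      by (rule sum.reindex_bij_witness
            [of _ "\<lambda>((a, k), (b, l)). ((a + b, l), (a, b))" "\<lambda>((k, l), (a, b)). ((a, b + l), (b, l))"])
         (auto simp: add.assoc mult.assoc)
    also have "\<dots> = (\<Sum>p \<in> ?D m. \<Sum>s \<in> ?D (snd p). f (fst p) * (g (fst s) * h (snd s)))"
      by (rule sum.Sigma[symmetric]) (auto simp: finite_multiindex_decomp)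
    also have "\<dots> = (\<Sum>(a, k) \<in> ?D m. f a * (\<Sum>(b, l) \<in> ?D k. g b * h l))"
      by (simp add: case_prod_unfold sum_distrib_left)
    finally show "(\<Sum>(k, l) \<in> ?D m. (\<Sum>(a, b) \<in> ?D k. f a * g b) * h l)
        = (\<Sum>(a, k) \<in> ?D m. f a * (\<Sum>(b, l) \<in> ?D k. g b * h l))" .
  qed
qed

end

lift_definition mfps_const :: "'a::zero \<Rightarrow> ('a, 'n::finite) mfps"
  is "\<lambda>c m. if m = 0 then c else 0" .

lift_definition mfps_var :: "'n::finite \<Rightarrow> ('a::zero_neq_one, 'n) mfps"
  is "\<lambda>\<alpha> m. if m = axis \<alpha> 1 then 1 else 0" .

lift_definition mfps_deriv :: "'n::finite \<Rightarrow> ('a::semiring_1, 'n) mfps \<Rightarrow> ('a, 'n) mfps"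
  is "\<lambda>\<alpha> f m. of_nat (m $ \<alpha> + 1) * f (m + axis \<alpha> 1)" .

definition mfps_at_zero :: "('a, 'n::finite) mfps \<Rightarrow> 'a" where
  "mfps_at_zero f = mfps_nth f 0"

definition mfps_poly_degree_le :: "nat \<Rightarrow> ('a::zero, 'n::finite) mfps \<Rightarrow> bool" where
  "mfps_poly_degree_le d f \<longleftrightarrow> (\<forall>m. (\<Sum>\<alpha>\<in>UNIV. m $ \<alpha>) > d \<longrightarrow> mfps_nth f m = 0)"

text \<open>In \<open>complex\<close>, \<open>summable_on\<close> is unconditional, i.e. absolute, convergence.\<close>

definition mfps_converges_at :: "(complex, 'n::finite) mfps \<Rightarrow> complex ^ 'n \<Rightarrow> bool" where
  "mfps_converges_at f t \<longleftrightarrow>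
     (\<lambda>m. mfps_nth f m * (\<Prod>\<alpha>\<in>UNIV. (t $ \<alpha>) ^ (m $ \<alpha>))) summable_on UNIV"

definition mfps_tuple_convergent :: "(complex, 'n::finite) mfps ^ 'n \<Rightarrow> bool" where
  "mfps_tuple_convergent F \<longleftrightarrow>
     (\<exists>U. open U \<and> 0 \<in> U \<and> (\<forall>t\<in>U. \<forall>\<alpha>. mfps_converges_at (F $ \<alpha>) t))"

subsection \<open>Formal flat F-manifolds\<close>

text \<open>\<open>structure_coeff F \<alpha> \<beta> \<gamma>\<close> is the \<open>\<alpha>\<close>-component of
  \<open>\<partial>/\<partial>t\<^sup>\<beta> \<circ> \<partial>/\<partial>t\<^sup>\<gamma>\<close>.\<close>

definition structure_coeff ::
  "(complex, 'n::finite) mfps ^ 'n \<Rightarrow> 'n \<Rightarrow> 'n \<Rightarrow> 'n \<Rightarrow> (complex, 'n) mfps" where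
  "structure_coeff F \<alpha> \<beta> \<gamma> = mfps_deriv \<beta> (mfps_deriv \<gamma> (F $ \<alpha>))"

definition oriented_associativity :: "complex ^ 'n \<Rightarrow> (complex, 'n::finite) mfps ^ 'n \<Rightarrow> bool" where
  "oriented_associativity A F \<longleftrightarrow>
     (\<forall>\<alpha> \<beta>. (\<Sum>\<mu>\<in>UNIV. mfps_const (A $ \<mu>) * structure_coeff F \<alpha> \<mu> \<beta>) = (if \<alpha> = \<beta> then 1 else 0)) \<and>
     (\<forall>\<alpha> \<beta> \<gamma> \<epsilon>.
        (\<Sum>\<mu>\<in>UNIV. structure_coeff F \<alpha> \<mu> \<beta> * structure_coeff F \<mu> \<gamma> \<epsilon>) =
        (\<Sum>\<mu>\<in>UNIV. structure_coeff F \<alpha> \<mu> \<gamma> * structure_coeff F \<mu> \<beta> \<epsilon>))"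

definition euler_field :: "complex ^ 'n \<Rightarrow> complex ^ 'n \<Rightarrow> (complex, 'n::finite) mfps ^ 'n" where
  "euler_field q r = (\<chi> \<alpha>. mfps_const (1 - q $ \<alpha>) * mfps_var \<alpha> + mfps_const (r $ \<alpha>))"

definition field_apply ::
  "(complex, 'n::finite) mfps ^ 'n \<Rightarrow> (complex, 'n) mfps \<Rightarrow> (complex, 'n) mfps" where
  "field_apply X f = (\<Sum>\<alpha>\<in>UNIV. X $ \<alpha> * mfps_deriv \<alpha> f)"

definition quasi_homogeneous ::
  "complex ^ 'n \<Rightarrow> complex ^ 'n \<Rightarrow> (complex, 'n::finite) mfps ^ 'n \<Rightarrow> bool" where
  "quasi_homogeneous q r F \<longleftrightarrow>
     (\<forall>\<beta>. \<exists>P. mfps_poly_degree_le 1 P \<and>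
        field_apply (euler_field q r) (F $ \<beta>) = mfps_const (2 - q $ \<beta>) * F $ \<beta> + P)"

definition product_at_zero ::
  "(complex, 'n::finite) mfps ^ 'n \<Rightarrow> complex ^ 'n \<Rightarrow> complex ^ 'n \<Rightarrow> complex ^ 'n" where
  "product_at_zero F v w =
     (\<chi> \<alpha>. \<Sum>\<beta>\<in>UNIV. \<Sum>\<gamma>\<in>UNIV. v $ \<beta> * w $ \<gamma> * mfps_at_zero (structure_coeff F \<alpha> \<beta> \<gamma>))"

definition idempotent_basis ::
  "(complex, 'n::finite) mfps ^ 'n \<Rightarrow> ('n \<Rightarrow> complex ^ 'n) \<Rightarrow> bool" where
  "idempotent_basis F \<pi> \<longleftrightarrow>
     inj \<pi> \<and> vec.independent (range \<pi>) \<and> vec.span (range \<pi>) = UNIV \<and>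
     (\<forall>i j. product_at_zero F (\<pi> i) (\<pi> j) = (if i = j then \<pi> i else 0))"

definition semisimple_at_zero :: "(complex, 'n::finite) mfps ^ 'n \<Rightarrow> bool" where
  "semisimple_at_zero F \<longleftrightarrow> (\<exists>\<pi>. idempotent_basis F \<pi>)"

definition euler_field_at_zero :: "complex ^ 'n \<Rightarrow> complex ^ 'n \<Rightarrow> complex ^ 'n::finite" where
  "euler_field_at_zero q r = (\<chi> \<alpha>. mfps_at_zero (euler_field q r $ \<alpha>))"

definition mu_zero :: "complex ^ 'n \<Rightarrow> complex ^ 'n \<Rightarrow> complex ^ 'n::finite" where
  "mu_zero q v = (\<chi> \<alpha>. q $ \<alpha> * v $ \<alpha>)"

text \<open>An idempotent basis is unique up to reordering and determines \<open>u\<close> (the values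
  \<open>u\<^sup>i\<^sub>o\<close>) and \<open>\<delta>\<close> (the conformal dimensions), so quantifying existentially over all three
  involves no choice.\<close>

definition strictly_doubly_resonant ::
  "complex ^ 'n \<Rightarrow> complex ^ 'n \<Rightarrow> (complex, 'n::finite) mfps ^ 'n \<Rightarrow> bool" where
  "strictly_doubly_resonant q r F \<longleftrightarrow>
     (\<exists>\<pi> u \<delta>. idempotent_basis F \<pi> \<and>
        (\<forall>i. product_at_zero F (euler_field_at_zero q r) (\<pi> i) = u i *s \<pi> i) \<and>
        (\<forall>i. product_at_zero F (mu_zero q (\<pi> i)) (\<pi> i) = \<delta> i *s \<pi> i) \<and>
        (\<exists>i j. i \<noteq> j \<and> u i = u j \<and> \<delta> i - \<delta> j \<in> \<int> - {0}))"

end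

theory Submission
  imports Defs
begin

text \<open>
  The idea is to describe the manifold in its idempotent frame, where it solves a system of polynomial
  differential equations along a single vector field with a non-degenerate zero at the origin,
  and to prove a Briot--Bouquet theorem: formal solutions of such systems converge.

  \<^bold>\<open>Geometry.\<close> The idempotents at the origin extend to formal idempotent vector fields (lemma
  \<open>formal_idempotent_frame\<close>), the columns of an invertible matrix \<open>P\<close> with inverse \<open>\<Psi>\<close>. The
  eigenvalues \<open>U\<close> of the multiplication by the Euler field are canonical coordinates
  (\<open>deriv_U\<close>). The derivative of the frame is governed by rotation coefficients \<open>g\<close>
  (\<open>W_offdiag\<close>), and the operator \<open>\<mu>\<close> has in the frame the matrix \<open>V\<close> with
  \<open>V i j = (U i - U j) * g i j\<close> off the diagonal (\<open>V_offdiag\<close>).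

  \<^bold>\<open>The system.\<close> Let \<open>v = U - U(0)\<close> and let \<open>D\<close> be the derivative along the field \<open>H\<close> with \<open>D v = v\<close>. Along
  \<open>H\<close>, the series \<open>P\<close>, \<open>\<Psi>\<close> and \<open>V\<close> satisfy polynomial equations in \<open>P\<close>, \<open>\<Psi>\<close>, \<open>V\<close>, \<open>g\<close> and \<open>v\<close>. So
  does \<open>g i j\<close>: if \<open>U i\<close> and \<open>U j\<close> differ at the origin, then \<open>g i j\<close> is the quotient of \<open>V i j\<close> by a unit; if
  they coalesce, then \<open>D (V i j)\<close> is divisible by \<open>v i - v j\<close> and the factor can be cancelled
  (\<open>D_g_coalescing\<close>).

  \<^bold>\<open>Convergence.\<close> In flat coordinates \<open>H\<close> is the radial field \<open>\<Sum>t\<^sup>\<alpha> \<partial>/\<partial>t\<^sup>\<alpha>\<close> plus terms of second order. The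
  radial field multiplies the part of degree \<open>k\<close> by \<open>k\<close>, so in high degrees the equations become
  a contraction; lemma \<open>bounded_of_dominated_system\<close> turns this into convergence of all
  unknowns. The structure functions are polynomials in \<open>P\<close> and \<open>\<Psi>\<close>, and \<open>F\<close> arises from them by two
  integrations.
\<close>

section \<open>Multi-indices and coefficients\<close>

definition mdeg :: "nat ^ 'n::finite \<Rightarrow> nat" where
  "mdeg m = (\<Sum>\<alpha>\<in>UNIV. m $ \<alpha>)"

lemma mdeg_add [simp]: "mdeg (k + l) = mdeg k + mdeg l"
  by (simp add: mdeg_def sum.distrib)

lemma mdeg_zero [simp]: "mdeg 0 = 0"
  by (simp add: mdeg_def)

lemma mdeg_axis [simp]: "mdeg (axis \<alpha> (Suc 0)) = 1"
  by (simp add: mdeg_def axis_def)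

lemma mdeg_eq_0_iff [simp]: "mdeg m = 0 \<longleftrightarrow> m = 0"
  by (auto simp: mdeg_def vec_eq_iff)

lemma component_le_mdeg: "m $ \<alpha> \<le> mdeg m"
  unfolding mdeg_def by (intro member_le_sum) auto

lemma finite_mdeg_le [simp]: "finite {m :: nat ^ 'n::finite. mdeg m \<le> M}"
proof -
  have "{m :: nat ^ 'n. mdeg m \<le> M} \<subseteq> vec_lambda ` (Pi\<^sub>E UNIV (\<lambda>_. {..M}))"
  proof
    fix m :: "nat ^ 'n" assume "m \<in> {m. mdeg m \<le> M}"
    then have "m $ \<alpha> \<le> M" for \<alpha> using component_le_mdeg[of m \<alpha>] by simp
    then show "m \<in> vec_lambda ` (Pi\<^sub>E UNIV (\<lambda>_. {..M}))"
      by (intro image_eqI[of _ _ "vec_nth m"]) (auto simp: vec_nth_inverse PiE_UNIV_domain)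
  qed
  then show ?thesis by (rule finite_subset) (intro finite_imageI finite_PiE; simp)
qed

lemma finite_mdeg_le_conj [simp]:
  "finite {m :: nat ^ 'n::finite. mdeg m \<le> M \<and> Q m}" "finite {m :: nat ^ 'n::finite. Q m \<and> mdeg m \<le> M}"
  by (rule finite_subset[OF _ finite_mdeg_le[of M]]; auto)+

lemma finite_mdeg_less [simp]: "finite {m :: nat ^ 'n::finite. mdeg m < M}"
  by (rule finite_subset[OF _ finite_mdeg_le[of M]]) auto

lemma nonzero_index_split:
  fixes m :: "nat ^ 'n::finite"
  assumes "m $ \<alpha> > 0" obtains l where "m = l + axis \<alpha> 1"
proof
  show "m = (\<chi> \<beta>. m $ \<beta> - (axis \<alpha> 1 :: nat ^ _) $ \<beta>) + axis \<alpha> 1"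
    using assms by (auto simp: vec_eq_iff axis_def)
qed

lemma axis_add_eq_iff: "axis \<alpha> (Suc 0) + k = axis \<alpha> (Suc 0) + l \<longleftrightarrow> k = (l :: nat ^ 'n::finite)"
  by (auto simp: vec_eq_iff)

lemmas mfps_nth_simps [simp] =
  zero_mfps.rep_eq one_mfps.rep_eq plus_mfps.rep_eq minus_mfps.rep_eq uminus_mfps.rep_eq
  mfps_const.rep_eq mfps_var.rep_eq mfps_deriv.rep_eq

lemma mfps_nth_sum [simp]: "mfps_nth (\<Sum>i\<in>I. f i) m = (\<Sum>i\<in>I. mfps_nth (f i) m)"
  by (induction I rule: infinite_finite_induct) auto

lemma mfps_nth_mult: "mfps_nth (f * g) m = (\<Sum>(k, l) \<in> {(k, l). k + l = m}. mfps_nth f k * mfps_nth g l)"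
  by (simp add: times_mfps.rep_eq)

lemma mfps_nth_mult_zero [simp]: "mfps_nth (f * g) 0 = mfps_nth f 0 * mfps_nth g 0"
proof -
  have "{(k, l). k + l = (0 :: nat ^ 'b)} = {(0, 0)}"
    by (auto simp: vec_eq_iff)
  then show ?thesis by (simp add: mfps_nth_mult)
qed

lemma mfps_nth_const_mult [simp]:
  fixes f :: "('a::comm_ring_1, 'n::finite) mfps"
  shows "mfps_nth (mfps_const c * f) m = c * mfps_nth f m"
proof -
  have "mfps_nth (mfps_const c * f) m
      = (\<Sum>(k, l) \<in> {(0 :: nat ^ 'n, m)}. mfps_nth (mfps_const c) k * mfps_nth f l)"
    unfolding mfps_nth_mult
    by (rule sum.mono_neutral_right) (auto simp: finite_multiindex_decomp split: if_splits)
  then show ?thesis by simp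
qed

lemma mfps_nth_var_mult:
  fixes f :: "('a::comm_ring_1, 'n::finite) mfps"
  shows "mfps_nth (mfps_var \<alpha> * f) (axis \<alpha> 1 + m) = mfps_nth f m"
    and "k $ \<alpha> = 0 \<Longrightarrow> mfps_nth (mfps_var \<alpha> * f) k = 0"
proof -
  have "mfps_nth (mfps_var \<alpha> * f) (axis \<alpha> 1 + m)
      = (\<Sum>(k, l) \<in> {(axis \<alpha> 1, m)}. mfps_nth (mfps_var \<alpha>) k * mfps_nth f l)"
    unfolding mfps_nth_mult
    by (rule sum.mono_neutral_right)
       (auto simp: finite_multiindex_decomp axis_add_eq_iff split: if_splits)
  then show "mfps_nth (mfps_var \<alpha> * f) (axis \<alpha> 1 + m) = mfps_nth f m" by simp
  show "mfps_nth (mfps_var \<alpha> * f) k = 0" if "k $ \<alpha> = 0"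
    unfolding mfps_nth_mult using that
    by (intro sum.neutral) (auto split: if_splits)
qed

lemma mfps_const_simps:
  "mfps_const 0 = (0 :: ('a::comm_ring_1, 'n::finite) mfps)"
  "mfps_const 1 = (1 :: ('a, 'n) mfps)"
  "mfps_const (a + b) = (mfps_const a + mfps_const b :: ('a, 'n) mfps)"
  "mfps_const (a - b) = (mfps_const a - mfps_const b :: ('a, 'n) mfps)"
  "mfps_const (a * b) = (mfps_const a * mfps_const b :: ('a, 'n) mfps)"
  by (auto intro!: mfps_eqI)

section \<open>Derivations\<close>

lemma mfps_deriv_add: "mfps_deriv \<alpha> (f + g) = mfps_deriv \<alpha> f + mfps_deriv \<alpha> g"
  by (rule mfps_eqI) (simp add: algebra_simps)

lemma mfps_deriv_const [simp]: "mfps_deriv \<alpha> (mfps_const c) = 0"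
  by (rule mfps_eqI) (auto simp: vec_eq_iff axis_def)

lemma mfps_deriv_var: "mfps_deriv \<alpha> (mfps_var \<beta> :: (complex, 'n::finite) mfps) = (if \<alpha> = \<beta> then 1 else 0)"
proof (rule mfps_eqI)
  fix m :: "nat ^ 'n"
  have "m + axis \<alpha> 1 = axis \<beta> 1 \<longleftrightarrow> \<alpha> = \<beta> \<and> m = 0"
  proof
    assume h: "m + axis \<alpha> 1 = axis \<beta> (1::nat)"
    then have "mdeg m = 0" by (metis One_nat_def add_right_cancel mdeg_add mdeg_axis plus_nat.add_0)
    then have "m = 0" by simp
    with h show "\<alpha> = \<beta> \<and> m = 0" by (simp add: axis_eq_axis)
  qed auto
  then show "mfps_nth (mfps_deriv \<alpha> (mfps_var \<beta> :: (complex, 'n) mfps)) m = mfps_nth (if \<alpha> = \<beta> then 1 else 0) m"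
    by (auto simp: vec_eq_iff)
qed

lemma mfps_deriv_commute:
  fixes f :: "('a::comm_ring_1, 'n::finite) mfps"
  shows "mfps_deriv \<alpha> (mfps_deriv \<beta> f) = mfps_deriv \<beta> (mfps_deriv \<alpha> f)"
proof (rule mfps_eqI)
  fix m :: "nat ^ 'n"
  have "m + axis \<alpha> 1 + axis \<beta> 1 = m + axis \<beta> 1 + axis \<alpha> 1"
    by (simp add: ac_simps)
  then show "mfps_nth (mfps_deriv \<alpha> (mfps_deriv \<beta> f)) m = mfps_nth (mfps_deriv \<beta> (mfps_deriv \<alpha> f)) m"
    by (cases "\<alpha> = \<beta>") (auto simp: axis_def mult_of_nat_commute mult.assoc[symmetric])
qed

lemma mfps_deriv_mult:
  fixes f g :: "('a::comm_ring_1, 'n::finite) mfps"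
  shows "mfps_deriv \<alpha> (f * g) = mfps_deriv \<alpha> f * g + f * mfps_deriv \<alpha> g"
proof (rule mfps_eqI)
  fix m :: "nat ^ 'n"
  let ?e = "axis \<alpha> 1 :: nat ^ 'n"
  let ?D = "\<lambda>m :: nat ^ 'n. {(k, l). k + l = m}"
  have half: "(\<Sum>(k, l) \<in> ?D (m + ?e). of_nat (k $ \<alpha>) * (mfps_nth f k * mfps_nth g l))
      = mfps_nth (mfps_deriv \<alpha> f * g) m" for f g :: "('a, 'n) mfps"
  proof -
    have "(\<Sum>(k, l) \<in> ?D (m + ?e). of_nat (k $ \<alpha>) * (mfps_nth f k * mfps_nth g l))
        = (\<Sum>(k, l) \<in> {(k, l). k + l = m + ?e \<and> k $ \<alpha> > 0}. of_nat (k $ \<alpha>) * (mfps_nth f k * mfps_nth g l))"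
      by (rule sum.mono_neutral_right) (auto simp: finite_multiindex_decomp intro!: gr0I)
    also have "\<dots> = (\<Sum>(k, l) \<in> ?D m. of_nat (k $ \<alpha> + 1) * mfps_nth f (k + ?e) * mfps_nth g l)"
    proof (rule sum.reindex_bij_witness[of _ "\<lambda>(k, l). (k + ?e, l)" "\<lambda>(k, l). (\<chi> \<beta>. k $ \<beta> - ?e $ \<beta>, l)"])
      fix p assume "p \<in> {(k, l). k + l = m + ?e \<and> k $ \<alpha> > 0}"
      then obtain k l where p: "p = (k, l)" "k + l = m + ?e" "k $ \<alpha> > 0" by auto
      obtain k' where k: "k = k' + ?e" using nonzero_index_split p(3) by blast
      have *: "(\<chi> \<beta>. k $ \<beta> - ?e $ \<beta>) = k'" unfolding k by (simp add: vec_eq_iff)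
      show "(case case p of (k, l) \<Rightarrow> (\<chi> \<beta>. k $ \<beta> - ?e $ \<beta>, l) of (k, l) \<Rightarrow> (k + ?e, l)) = p"
        using * k p by simp
      show "(case p of (k, l) \<Rightarrow> (\<chi> \<beta>. k $ \<beta> - ?e $ \<beta>, l)) \<in> ?D m"
        using p * unfolding k by (auto simp: vec_eq_iff)
      show "(case case p of (k, l) \<Rightarrow> (\<chi> \<beta>. k $ \<beta> - ?e $ \<beta>, l) of (k, l) \<Rightarrow> of_nat (k $ \<alpha> + 1) * mfps_nth f (k + ?e) * mfps_nth g l)
         = (case p of (k, l) \<Rightarrow> of_nat (k $ \<alpha>) * (mfps_nth f k * mfps_nth g l))"
        using p * k by (simp add: axis_def algebra_simps)
    next
      fix p assume "p \<in> ?D m"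
      then obtain k l where p: "p = (k, l)" "k + l = m" by auto
      show "(case case p of (k, l) \<Rightarrow> (k + ?e, l) of (k, l) \<Rightarrow> (\<chi> \<beta>. k $ \<beta> - ?e $ \<beta>, l)) = p"
        using p by (simp add: vec_eq_iff)
      show "(case p of (k, l) \<Rightarrow> (k + ?e, l)) \<in> {(k, l). k + l = m + ?e \<and> k $ \<alpha> > 0}"
        using p by (auto simp: algebra_simps axis_def)
    qed
    also have "\<dots> = mfps_nth (mfps_deriv \<alpha> f * g) m"
      by (simp add: mfps_nth_mult)
    finally show ?thesis .
  qed
  have swap: "(\<Sum>(k, l) \<in> ?D (m + ?e). of_nat (l $ \<alpha>) * (mfps_nth f k * mfps_nth g l))
      = (\<Sum>(k, l) \<in> ?D (m + ?e). of_nat (k $ \<alpha>) * (mfps_nth g k * mfps_nth f l))"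
    by (rule sum.reindex_bij_witness[of _ prod.swap prod.swap]) (auto simp: algebra_simps)
  have "mfps_nth (mfps_deriv \<alpha> (f * g)) m
      = (\<Sum>(k, l) \<in> ?D (m + ?e). of_nat ((m + ?e) $ \<alpha>) * (mfps_nth f k * mfps_nth g l))"
    by (simp add: mfps_nth_mult sum_distrib_left case_prod_unfold axis_def)
  also have "\<dots> = (\<Sum>(k, l) \<in> ?D (m + ?e). of_nat (k $ \<alpha>) * (mfps_nth f k * mfps_nth g l))
      + (\<Sum>(k, l) \<in> ?D (m + ?e). of_nat (l $ \<alpha>) * (mfps_nth f k * mfps_nth g l))"
    unfolding sum.distrib[symmetric]
  proof (rule sum.cong[OF refl], unfold split_paired_all case_prod_conv mem_Collect_eq)
    fix k l assume "k + l = m + ?e"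
    then have "(m + ?e) $ \<alpha> = k $ \<alpha> + l $ \<alpha>"
      by (simp only: vector_add_component[symmetric])
    then show "of_nat ((m + ?e) $ \<alpha>) * (mfps_nth f k * mfps_nth g l)
        = of_nat (k $ \<alpha>) * (mfps_nth f k * mfps_nth g l) + of_nat (l $ \<alpha>) * (mfps_nth f k * mfps_nth g l)"
      by (simp only: of_nat_add distrib_right)
  qed
  also have "\<dots> = mfps_nth (mfps_deriv \<alpha> f * g + f * mfps_deriv \<alpha> g) m"
    unfolding swap half by (simp add: mult.commute)
  finally show "mfps_nth (mfps_deriv \<alpha> (f * g)) m = mfps_nth (mfps_deriv \<alpha> f * g + f * mfps_deriv \<alpha> g) m" .
qed

text \<open>The arguments below use both the coordinate derivations and the derivation along one formal
  vector field, so the product rule is packaged once for all of them.\<close>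

definition derivation :: "((complex, 'n::finite) mfps \<Rightarrow> (complex, 'n) mfps) \<Rightarrow> bool" where
  "derivation d \<longleftrightarrow> (\<forall>f g. d (f + g) = d f + d g) \<and> (\<forall>f g. d (f * g) = d f * g + f * d g)
     \<and> (\<forall>c. d (mfps_const c) = 0)"

lemma derivationD:
  assumes "derivation d"
  shows "d (f + g) = d f + d g" "d (f * g) = d f * g + f * d g" "d (mfps_const c) = 0"
    "d 0 = 0" "d 1 = 0" "d (f - g) = d f - d g" "d (- f) = - d f"
    "d (\<Sum>i\<in>I. h i) = (\<Sum>i\<in>I. d (h i))"
proof -
  show add: "d (f + g) = d f + d g" and "d (f * g) = d f * g + f * d g"
    and c: "d (mfps_const c) = 0" for f g c
    using assms by (auto simp: derivation_def)
  from c[of 0] c[of 1] show z: "d 0 = 0" and "d 1 = 0" by (auto simp: mfps_const_simps)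
  show "d (f - g) = d f - d g" using add[of "f - g" g] by simp
  show "d (- f) = - d f" using add[of f "- f"] z by (simp add: eq_neg_iff_add_eq_0 add.commute)
  show "d (\<Sum>i\<in>I. h i) = (\<Sum>i\<in>I. d (h i))"
    by (induction I rule: infinite_finite_induct) (auto simp: z add)
qed

lemma derivation_mfps_deriv: "derivation (mfps_deriv \<alpha>)"
  by (simp add: derivation_def mfps_deriv_add mfps_deriv_mult)

lemma derivation_field_apply: "derivation (field_apply X)"
  unfolding derivation_def field_apply_def
  by (simp add: mfps_deriv_add mfps_deriv_mult sum.distrib sum_distrib_left algebra_simps)

lemmas mfps_deriv_rules = derivationD[OF derivation_mfps_deriv]
lemmas field_apply_rules = derivationD[OF derivation_field_apply]

section \<open>Convergence from a singular first-order system\<close>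

text \<open>The truncated norms are weighted sums of the absolute values of the coefficients, with the
  weights of the norm \<open>\<bar>f(0)\<bar> + \<parallel>f'\<parallel>\<close> of a power series at radius \<open>\<rho>\<close>. A factor of the degree is
  built in because in the system below the unknowns appear differentiated once: the
  derivative is then controlled by the norm of the function itself, whereas an undifferentiated
  term of degree above \<open>K\<close> gains the factor \<open>1 / K\<close>. Truncation at degree \<open>M\<close> makes all sums finite;
  convergence is boundedness uniformly in \<open>M\<close>.\<close>

definition norm_weight :: "real \<Rightarrow> nat \<Rightarrow> real" where
  "norm_weight \<rho> k = (if k = 0 then 1 else real k * \<rho> ^ (k - 1))"

definition trunc_norm :: "real \<Rightarrow> nat \<Rightarrow> (complex, 'n::finite) mfps \<Rightarrow> real" where
  "trunc_norm \<rho> M f = (\<Sum>m | mdeg m \<le> M. norm_weight \<rho> (mdeg m) * norm (mfps_nth f m))"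

lemma norm_weight_nonneg [simp]: "0 \<le> \<rho> \<Longrightarrow> 0 \<le> norm_weight \<rho> k"
  by (simp add: norm_weight_def)

text \<open>This is what makes the norms submultiplicative. The restriction on \<open>\<rho>\<close> absorbs the sum of the two
  degrees into their product.\<close>

lemma norm_weight_add_le:
  assumes "0 \<le> \<rho>" "\<rho> \<le> 1/2"
  shows "norm_weight \<rho> (k + l) \<le> norm_weight \<rho> k * norm_weight \<rho> l"
proof (cases k)
  case (Suc a)
  show ?thesis
  proof (cases l)
    case (Suc b)
    have "(real a + real b + 2) * \<rho> \<le> (real a + real b + 2) * (1/2)"
      using assms by (intro mult_left_mono) auto
    also have "\<dots> \<le> (real a + 1) * (real b + 1)"
      by (simp add: algebra_simps) (rule order_trans[of _ "real a + real b"], simp, simp)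
    finally have "((real a + real b + 2) * \<rho>) * \<rho> ^ (a + b) \<le> ((real a + 1) * (real b + 1)) * \<rho> ^ (a + b)"
      using assms by (intro mult_right_mono) auto
    then show ?thesis
      using \<open>k = Suc a\<close> Suc by (simp add: norm_weight_def power_add algebra_simps)
  qed (simp add: norm_weight_def)
qed (simp add: norm_weight_def)

lemma trunc_norm_nonneg [simp]: "0 \<le> \<rho> \<Longrightarrow> 0 \<le> trunc_norm \<rho> M f"
  by (auto simp: trunc_norm_def intro!: sum_nonneg)

lemma weighted_mult_bound:
  fixes f g :: "(complex, 'n::finite) mfps"
  assumes "finite S" "\<And>m. m \<in> S \<Longrightarrow> 0 \<le> \<omega> m"
  shows "(\<Sum>m\<in>S. \<omega> m * norm (mfps_nth (f * g) m))
    \<le> (\<Sum>(k, l) \<in> {(k, l). k + l \<in> S}. \<omega> (k + l) * (norm (mfps_nth f k) * norm (mfps_nth g l)))"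
proof -
  have "(\<Sum>m\<in>S. \<omega> m * norm (mfps_nth (f * g) m))
      \<le> (\<Sum>m\<in>S. \<Sum>p \<in> {(k, l). k + l = m}. \<omega> m * (norm (mfps_nth f (fst p)) * norm (mfps_nth g (snd p))))"
  proof (rule sum_mono)
    fix m assume "m \<in> S"
    have "norm (mfps_nth (f * g) m) \<le> (\<Sum>p \<in> {(k, l). k + l = m}. norm (mfps_nth f (fst p)) * norm (mfps_nth g (snd p)))"
      unfolding mfps_nth_mult by (rule order_trans[OF norm_sum]) (simp add: case_prod_unfold norm_mult)
    then show "\<omega> m * norm (mfps_nth (f * g) m)
        \<le> (\<Sum>p \<in> {(k, l). k + l = m}. \<omega> m * (norm (mfps_nth f (fst p)) * norm (mfps_nth g (snd p))))"
      unfolding sum_distrib_left[symmetric] using assms(2)[OF \<open>m \<in> S\<close>] by (rule mult_left_mono)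
  qed
  also have "\<dots> = (\<Sum>(m, p) \<in> Sigma S (\<lambda>m. {(k, l). k + l = m}). \<omega> m * (norm (mfps_nth f (fst p)) * norm (mfps_nth g (snd p))))"
    by (rule sum.Sigma) (auto simp: assms finite_multiindex_decomp)
  also have "\<dots> = (\<Sum>(k, l) \<in> {(k, l). k + l \<in> S}. \<omega> (k + l) * (norm (mfps_nth f k) * norm (mfps_nth g l)))"
    by (rule sum.reindex_bij_witness[of _ "\<lambda>(k, l). (k + l, (k, l))" snd]) auto
  finally show ?thesis .
qed

lemma trunc_norm_mult:
  assumes "0 \<le> \<rho>" "\<rho> \<le> 1/2"
  shows "trunc_norm \<rho> M (f * g) \<le> trunc_norm \<rho> M f * trunc_norm \<rho> M (g :: (complex, 'n::finite) mfps)"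
proof -
  let ?B = "{m :: nat ^ 'n. mdeg m \<le> M}"
  have "trunc_norm \<rho> M (f * g) \<le> (\<Sum>(k, l) \<in> {(k, l). k + l \<in> ?B}. norm_weight \<rho> (mdeg (k + l)) * (norm (mfps_nth f k) * norm (mfps_nth g l)))"
    unfolding trunc_norm_def using assms by (intro weighted_mult_bound) auto
  also have "\<dots> \<le> (\<Sum>(k, l) \<in> {(k, l). k + l \<in> ?B}. (norm_weight \<rho> (mdeg k) * norm (mfps_nth f k)) * (norm_weight \<rho> (mdeg l) * norm (mfps_nth g l)))"
  proof (rule sum_mono, clarify)
    fix k l :: "nat ^ 'n"
    have "norm_weight \<rho> (mdeg (k + l)) * (norm (mfps_nth f k) * norm (mfps_nth g l))
       \<le> (norm_weight \<rho> (mdeg k) * norm_weight \<rho> (mdeg l)) * (norm (mfps_nth f k) * norm (mfps_nth g l))"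
      using norm_weight_add_le[OF assms] by (intro mult_right_mono) auto
    then show "norm_weight \<rho> (mdeg (k + l)) * (norm (mfps_nth f k) * norm (mfps_nth g l))
       \<le> (norm_weight \<rho> (mdeg k) * norm (mfps_nth f k)) * (norm_weight \<rho> (mdeg l) * norm (mfps_nth g l))"
      by (simp add: mult_ac)
  qed
  also have "\<dots> \<le> (\<Sum>(k, l) \<in> ?B \<times> ?B. (norm_weight \<rho> (mdeg k) * norm (mfps_nth f k)) * (norm_weight \<rho> (mdeg l) * norm (mfps_nth g l)))"
    using assms by (intro sum_mono2) auto
  also have "\<dots> = trunc_norm \<rho> M f * trunc_norm \<rho> M g"
    unfolding trunc_norm_def sum_product sum.cartesian_product by simp
  finally show ?thesis .
qed

lemma trunc_norm_add: "0 \<le> \<rho> \<Longrightarrow> trunc_norm \<rho> M (f + g) \<le> trunc_norm \<rho> M f + trunc_norm \<rho> M g"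
  unfolding trunc_norm_def sum.distrib[symmetric]
  by (intro sum_mono) (auto simp flip: distrib_left intro!: mult_left_mono norm_triangle_ineq)

lemma trunc_norm_uminus: "trunc_norm \<rho> M (- f) = trunc_norm \<rho> M f"
  by (simp add: trunc_norm_def)

lemma trunc_norm_const: "trunc_norm \<rho> M (mfps_const c :: (complex, 'n::finite) mfps) = norm c"
proof -
  have "trunc_norm \<rho> M (mfps_const c :: (complex, 'n) mfps)
      = (\<Sum>m\<in>{0 :: nat ^ 'n}. norm_weight \<rho> (mdeg m) * norm (mfps_nth (mfps_const c) m))"
    unfolding trunc_norm_def by (rule sum.mono_neutral_right) auto
  then show ?thesis by (simp add: norm_weight_def)
qed

text \<open>A series is dominated by a set of series if bounds on the norms of the latter force a bound on its
  own norm, with constants that do not depend on the radius or on the truncation. Every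
  polynomial expression in the elements of \<open>Y\<close> is dominated by \<open>Y\<close>, so the predicate stands for
  ``polynomial right-hand side'' without a syntax of polynomials.\<close>

definition dominated :: "(complex, 'n::finite) mfps set \<Rightarrow> (complex, 'n) mfps \<Rightarrow> bool" where
  "dominated Y f \<longleftrightarrow> (\<forall>B. \<exists>G. \<forall>\<rho> M. 0 \<le> \<rho> \<longrightarrow> \<rho> \<le> 1/2 \<longrightarrow>
     (\<forall>y\<in>Y. trunc_norm \<rho> M y \<le> B) \<longrightarrow> trunc_norm \<rho> M f \<le> G)"

named_theorems dom_intros

lemma dominatedI:
  assumes "\<And>B. \<exists>G. \<forall>\<rho> M. 0 \<le> \<rho> \<longrightarrow> \<rho> \<le> 1/2 \<longrightarrow>
     (\<forall>y\<in>Y. trunc_norm \<rho> M y \<le> B) \<longrightarrow> trunc_norm \<rho> M f \<le> G"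
  shows "dominated Y f"
  using assms by (auto simp: dominated_def)

lemma dominated_member: "f \<in> Y \<Longrightarrow> dominated Y f"
  by (auto simp: dominated_def)

lemma dominated_const [dom_intros]: "dominated Y (mfps_const c)"
  by (rule dominatedI) (auto simp: trunc_norm_const)

lemma dominated_add [dom_intros]:
  assumes "dominated Y f" "dominated Y g" shows "dominated Y (f + g)"
proof (rule dominatedI)
  fix B
  obtain G1 where G1: "\<forall>\<rho> M. 0 \<le> \<rho> \<longrightarrow> \<rho> \<le> 1/2 \<longrightarrow>
     (\<forall>y\<in>Y. trunc_norm \<rho> M y \<le> B) \<longrightarrow> trunc_norm \<rho> M f \<le> G1"
    using assms(1) unfolding dominated_def by blast
  obtain G2 where G2: "\<forall>\<rho> M. 0 \<le> \<rho> \<longrightarrow> \<rho> \<le> 1/2 \<longrightarrow>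
     (\<forall>y\<in>Y. trunc_norm \<rho> M y \<le> B) \<longrightarrow> trunc_norm \<rho> M g \<le> G2"
    using assms(2) unfolding dominated_def by blast
  show "\<exists>G. \<forall>\<rho> M. 0 \<le> \<rho> \<longrightarrow> \<rho> \<le> 1/2 \<longrightarrow>
     (\<forall>y\<in>Y. trunc_norm \<rho> M y \<le> B) \<longrightarrow> trunc_norm \<rho> M (f + g) \<le> G"
  proof (intro exI[of _ "G1 + G2"] allI impI)
    fix \<rho> :: real and M assume *: "0 \<le> \<rho>" "\<rho> \<le> 1/2" "\<forall>y\<in>Y. trunc_norm \<rho> M y \<le> B"
    show "trunc_norm \<rho> M (f + g) \<le> G1 + G2"
      using trunc_norm_add[OF *(1), of M f g] G1[rule_format, OF *(1,2)] G2[rule_format, OF *(1,2)] *(3) by force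
  qed
qed

lemma dominated_uminus [dom_intros]: "dominated Y f \<Longrightarrow> dominated Y (- f)"
  by (simp add: dominated_def trunc_norm_uminus)

lemma dominated_diff [dom_intros]: "dominated Y f \<Longrightarrow> dominated Y g \<Longrightarrow> dominated Y (f - g)"
  using dominated_add[of Y f "- g"] dominated_uminus[of Y g] by simp

lemma dominated_mult [dom_intros]:
  assumes "dominated Y f" "dominated Y g" shows "dominated Y (f * g)"
proof (rule dominatedI)
  fix B
  obtain G1 where G1: "\<forall>\<rho> M. 0 \<le> \<rho> \<longrightarrow> \<rho> \<le> 1/2 \<longrightarrow>
     (\<forall>y\<in>Y. trunc_norm \<rho> M y \<le> B) \<longrightarrow> trunc_norm \<rho> M f \<le> G1"
    using assms(1) unfolding dominated_def by blast
  obtain G2 where G2: "\<forall>\<rho> M. 0 \<le> \<rho> \<longrightarrow> \<rho> \<le> 1/2 \<longrightarrow>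
     (\<forall>y\<in>Y. trunc_norm \<rho> M y \<le> B) \<longrightarrow> trunc_norm \<rho> M g \<le> G2"
    using assms(2) unfolding dominated_def by blast
  show "\<exists>G. \<forall>\<rho> M. 0 \<le> \<rho> \<longrightarrow> \<rho> \<le> 1/2 \<longrightarrow>
     (\<forall>y\<in>Y. trunc_norm \<rho> M y \<le> B) \<longrightarrow> trunc_norm \<rho> M (f * g) \<le> G"
  proof (intro exI[of _ "G1 * G2"] allI impI)
    fix \<rho> :: real and M assume *: "0 \<le> \<rho>" "\<rho> \<le> 1/2" "\<forall>y\<in>Y. trunc_norm \<rho> M y \<le> B"
    have f: "trunc_norm \<rho> M f \<le> G1" and g: "trunc_norm \<rho> M g \<le> G2"
      using G1[rule_format, OF *(1,2)] G2[rule_format, OF *(1,2)] *(3) by auto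
    have "0 \<le> G1" using f trunc_norm_nonneg[OF *(1), of M f] by linarith
    then show "trunc_norm \<rho> M (f * g) \<le> G1 * G2"
      using trunc_norm_mult[OF *(1,2), of M f g] mult_mono[OF f g] *(1) by (simp add: order_trans)
  qed
qed

lemma dominated_0 [dom_intros]: "dominated Y 0"
  using dominated_const[of Y 0] by (simp add: mfps_const_simps)

lemma dominated_sum [dom_intros]:
  "(\<And>i. i \<in> I \<Longrightarrow> dominated Y (f i)) \<Longrightarrow> dominated Y (\<Sum>i\<in>I. f i)"
  by (induction I rule: infinite_finite_induct) (auto intro: dom_intros)

text \<open>Euler's identity: the radial field multiplies the homogeneous part of degree \<open>k\<close> by \<open>k\<close>.\<close>

lemma euler_operator_nth:
  fixes f :: "(complex, 'n::finite) mfps"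
  shows "(\<Sum>\<alpha>\<in>UNIV. mfps_nth (mfps_var \<alpha> * mfps_deriv \<alpha> f) m) = of_nat (mdeg m) * mfps_nth f m"
proof -
  have "mfps_nth (mfps_var \<alpha> * mfps_deriv \<alpha> f) m = of_nat (m $ \<alpha>) * mfps_nth f m" for \<alpha>
  proof (cases "m $ \<alpha> = 0")
    case False
    then obtain l where l: "m = l + axis \<alpha> 1" using nonzero_index_split by blast
    then have m: "m = axis \<alpha> 1 + l" by (simp add: add.commute)
    have "mfps_nth (mfps_var \<alpha> * mfps_deriv \<alpha> f) m = mfps_nth (mfps_deriv \<alpha> f) l"
      unfolding m by (rule mfps_nth_var_mult)
    also have "\<dots> = of_nat (m $ \<alpha>) * mfps_nth f m"
      by (simp add: l axis_def)
    finally show ?thesis .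
  qed (simp add: mfps_nth_var_mult)
  then show ?thesis by (simp add: mdeg_def sum_distrib_right)
qed

lemma deriv_sum_le_trunc_norm:
  assumes "0 \<le> \<rho>"
  shows "(\<Sum>l | mdeg l < M. \<rho> ^ mdeg l * norm (mfps_nth (mfps_deriv \<alpha> f) l))
     \<le> trunc_norm \<rho> M (f :: (complex, 'n::finite) mfps)"
proof -
  let ?e = "axis \<alpha> 1 :: nat ^ 'n"
  have "(\<Sum>l | mdeg l < M. \<rho> ^ mdeg l * norm (mfps_nth (mfps_deriv \<alpha> f) l))
     \<le> (\<Sum>l | mdeg l < M. norm_weight \<rho> (mdeg (l + ?e)) * norm (mfps_nth f (l + ?e)))"
  proof (rule sum_mono)
    fix l :: "nat ^ 'n"
    have "norm (mfps_nth (mfps_deriv \<alpha> f) l) = (real (l $ \<alpha>) + 1) * norm (mfps_nth f (l + ?e))"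
      by (simp add: norm_mult add.commute[of 1] flip: of_nat_Suc del: of_nat_Suc)
    also have "\<dots> \<le> (real (mdeg l) + 1) * norm (mfps_nth f (l + ?e))"
      using component_le_mdeg[of l \<alpha>] by (intro mult_right_mono) auto
    finally have "\<rho> ^ mdeg l * norm (mfps_nth (mfps_deriv \<alpha> f) l)
        \<le> \<rho> ^ mdeg l * ((real (mdeg l) + 1) * norm (mfps_nth f (l + ?e)))"
      using assms by (intro mult_left_mono) auto
    then show "\<rho> ^ mdeg l * norm (mfps_nth (mfps_deriv \<alpha> f) l)
        \<le> norm_weight \<rho> (mdeg (l + ?e)) * norm (mfps_nth f (l + ?e))"
      by (simp add: norm_weight_def algebra_simps)
  qed
  also have "\<dots> = (\<Sum>m \<in> (\<lambda>l. l + ?e) ` {l. mdeg l < M}. norm_weight \<rho> (mdeg m) * norm (mfps_nth f m))"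
    by (subst sum.reindex) (auto simp: inj_on_def vec_eq_iff)
  also have "\<dots> \<le> trunc_norm \<rho> M f"
    unfolding trunc_norm_def using assms by (intro sum_mono2) auto
  finally show ?thesis .
qed

text \<open>Write \<open>H\<close> as the radial field plus a field \<open>h\<close> that vanishes to second order. By Euler's identity the
  coefficient of \<open>y\<close> at a multi-index \<open>m\<close>, multiplied by the degree of \<open>m\<close>, is that of \<open>H y\<close> minus that of
  \<open>h y\<close>. The first contribution carries no derivative and gains \<open>1 / K\<close>; in the second the
  differentiation of \<open>y\<close> is paid for by the degree in the weight.\<close>

lemma tail_estimate:
  fixes H :: "(complex, 'n::finite) mfps ^ 'n"
  assumes H0: "\<And>\<alpha>. mfps_nth (H $ \<alpha>) 0 = 0"
    and H1: "\<And>\<alpha> \<beta>. mfps_nth (H $ \<alpha>) (axis \<beta> 1) = (if \<alpha> = \<beta> then 1 else 0)"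
    and \<rho>: "0 \<le> \<rho>" and K: "0 < K"
  shows "(\<Sum>m | K < mdeg m \<and> mdeg m \<le> M. norm_weight \<rho> (mdeg m) * norm (mfps_nth y m))
     \<le> trunc_norm \<rho> M (field_apply H y) / K
       + (\<Sum>\<alpha>\<in>UNIV. \<Sum>k | 2 \<le> mdeg k \<and> mdeg k \<le> M. \<rho> ^ (mdeg k - 1) * norm (mfps_nth (H $ \<alpha>) k))
         * trunc_norm \<rho> M y"
proof -
  define h where "h \<alpha> = H $ \<alpha> - mfps_var \<alpha>" for \<alpha>
  let ?S = "{m :: nat ^ 'n. K < mdeg m \<and> mdeg m \<le> M}"
  let ?k = "{k :: nat ^ 'n. 2 \<le> mdeg k \<and> mdeg k \<le> M}"
  have low: "\<exists>\<beta>. k = axis \<beta> 1" if k: "mdeg k = 1" for k :: "nat ^ 'n"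
  proof -
    have "k \<noteq> 0" using k by auto
    then obtain \<beta> where "k $ \<beta> > 0" by (auto simp: vec_eq_iff)
    then obtain l where l: "k = l + axis \<beta> 1" using nonzero_index_split by blast
    then have "mdeg l = 0" using k by simp
    then show ?thesis using l by (metis mdeg_eq_0_iff add_0)
  qed
  have h0: "mfps_nth (h \<alpha>) k = 0" if "mdeg k < 2" for \<alpha> k
  proof -
    have "mdeg k = 0 \<or> mdeg k = 1" using that by linarith
    then show ?thesis
    proof
      assume "mdeg k = 0" then show ?thesis
        using H0 by (simp add: h_def)
    next
      assume "mdeg k = 1"
      then obtain \<beta> where k: "k = axis \<beta> 1" using low by blast
      show ?thesis using H1[of \<alpha> \<beta>] by (simp add: k h_def axis_eq_axis)
    qed
  qed
  have h2: "2 \<le> mdeg k" if "mfps_nth (h \<alpha>) k \<noteq> 0" for \<alpha> k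
    using h0[of k \<alpha>] that by fastforce
  have h1: "mfps_nth (h \<alpha>) k = mfps_nth (H $ \<alpha>) k" if "2 \<le> mdeg k" for \<alpha> k
    using that by (auto simp: h_def)
  have coeff: "of_nat (mdeg m) * mfps_nth y m
      = mfps_nth (field_apply H y) m - (\<Sum>\<alpha>\<in>UNIV. mfps_nth (h \<alpha> * mfps_deriv \<alpha> y) m)" for m
    by (simp add: h_def field_apply_def algebra_simps sum_subtractf euler_operator_nth
          del: mfps_deriv.rep_eq)
  have "(\<Sum>m\<in>?S. norm_weight \<rho> (mdeg m) * norm (mfps_nth y m))
      \<le> (\<Sum>m\<in>?S. norm_weight \<rho> (mdeg m) * norm (mfps_nth (field_apply H y) m) / K
          + (\<Sum>\<alpha>\<in>UNIV. \<rho> ^ (mdeg m - 1) * norm (mfps_nth (h \<alpha> * mfps_deriv \<alpha> y) m)))"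
  proof (rule sum_mono)
    fix m assume m: "m \<in> ?S"
    have "real (mdeg m) * norm (mfps_nth y m) = norm (of_nat (mdeg m) * mfps_nth y m)"
      by (simp add: norm_mult)
    also have "\<dots> \<le> norm (mfps_nth (field_apply H y) m) + (\<Sum>\<alpha>\<in>UNIV. norm (mfps_nth (h \<alpha> * mfps_deriv \<alpha> y) m))"
      unfolding coeff by (rule order_trans[OF norm_triangle_ineq4]) (auto intro: norm_sum)
    also have "\<dots> \<le> real (mdeg m) * norm (mfps_nth (field_apply H y) m) / K + (\<Sum>\<alpha>\<in>UNIV. norm (mfps_nth (h \<alpha> * mfps_deriv \<alpha> y) m))"
    proof -
      have "real K * norm (mfps_nth (field_apply H y) m) \<le> real (mdeg m) * norm (mfps_nth (field_apply H y) m)"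
        using m by (intro mult_right_mono) auto
      then show ?thesis using K by (simp add: field_simps)
    qed
    finally have "\<rho> ^ (mdeg m - 1) * (real (mdeg m) * norm (mfps_nth y m)) \<le> \<rho> ^ (mdeg m - 1) * \<dots>"
      using \<rho> by (intro mult_left_mono) auto
    then show "norm_weight \<rho> (mdeg m) * norm (mfps_nth y m) \<le> norm_weight \<rho> (mdeg m) * norm (mfps_nth (field_apply H y) m) / K
          + (\<Sum>\<alpha>\<in>UNIV. \<rho> ^ (mdeg m - 1) * norm (mfps_nth (h \<alpha> * mfps_deriv \<alpha> y) m))"
      using m by (auto simp: norm_weight_def distrib_left mult_ac sum_distrib_left)
  qed
  also have "\<dots> = (\<Sum>m\<in>?S. norm_weight \<rho> (mdeg m) * norm (mfps_nth (field_apply H y) m)) / K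
      + (\<Sum>\<alpha>\<in>UNIV. \<Sum>m\<in>?S. \<rho> ^ (mdeg m - 1) * norm (mfps_nth (h \<alpha> * mfps_deriv \<alpha> y) m))"
    by (simp add: sum.distrib sum_divide_distrib sum.swap[of _ ?S])
  also have "\<dots> \<le> trunc_norm \<rho> M (field_apply H y) / K
      + (\<Sum>\<alpha>\<in>UNIV. (\<Sum>k\<in>?k. \<rho> ^ (mdeg k - 1) * norm (mfps_nth (H $ \<alpha>) k)) * trunc_norm \<rho> M y)"
  proof (intro add_mono sum_mono divide_right_mono)
    show "(\<Sum>m\<in>?S. norm_weight \<rho> (mdeg m) * norm (mfps_nth (field_apply H y) m)) \<le> trunc_norm \<rho> M (field_apply H y)"
      unfolding trunc_norm_def using \<rho> by (intro sum_mono2) auto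
    fix \<alpha> :: 'n
    let ?d = "mfps_deriv \<alpha> y"
    let ?P = "{(k, l). k + l \<in> ?S \<and> 2 \<le> mdeg k}"
    have fin: "finite {(k, l). k + l \<in> ?S}"
      by (rule finite_subset[of _ "{m. mdeg m \<le> M} \<times> {m. mdeg m \<le> M}"]) auto
    have "(\<Sum>m\<in>?S. \<rho> ^ (mdeg m - 1) * norm (mfps_nth (h \<alpha> * ?d) m))
        \<le> (\<Sum>(k, l) \<in> {(k, l). k + l \<in> ?S}. \<rho> ^ (mdeg (k + l) - 1) * (norm (mfps_nth (h \<alpha>) k) * norm (mfps_nth ?d l)))"
      using \<rho> by (intro weighted_mult_bound) auto
    also have "\<dots> = (\<Sum>(k, l) \<in> ?P. \<rho> ^ (mdeg (k + l) - 1) * (norm (mfps_nth (h \<alpha>) k) * norm (mfps_nth ?d l)))"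
      using fin by (intro sum.mono_neutral_right) (auto intro: h2)
    also have "\<dots> = (\<Sum>(k, l) \<in> ?P. (\<rho> ^ (mdeg k - 1) * norm (mfps_nth (H $ \<alpha>) k)) * (\<rho> ^ mdeg l * norm (mfps_nth ?d l)))"
    proof (rule sum.cong[OF refl], clarify)
      fix k l :: "nat ^ 'n" assume k: "2 \<le> mdeg k"
      then have "mdeg (k + l) - 1 = (mdeg k - 1) + mdeg l" by simp
      then show "\<rho> ^ (mdeg (k + l) - 1) * (norm (mfps_nth (h \<alpha>) k) * norm (mfps_nth ?d l))
          = (\<rho> ^ (mdeg k - 1) * norm (mfps_nth (H $ \<alpha>) k)) * (\<rho> ^ mdeg l * norm (mfps_nth ?d l))"
        by (simp only: power_add h1[OF k] mult_ac)
    qed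
    also have "\<dots> \<le> (\<Sum>(k, l) \<in> ?k \<times> {l. mdeg l < M}. (\<rho> ^ (mdeg k - 1) * norm (mfps_nth (H $ \<alpha>) k)) * (\<rho> ^ mdeg l * norm (mfps_nth ?d l)))"
      using \<rho> by (intro sum_mono2 finite_cartesian_product) auto
    also have "\<dots> = (\<Sum>k\<in>?k. \<rho> ^ (mdeg k - 1) * norm (mfps_nth (H $ \<alpha>) k)) * (\<Sum>l | mdeg l < M. \<rho> ^ mdeg l * norm (mfps_nth ?d l))"
      unfolding sum_product sum.cartesian_product ..
    also have "\<dots> \<le> (\<Sum>k\<in>?k. \<rho> ^ (mdeg k - 1) * norm (mfps_nth (H $ \<alpha>) k)) * trunc_norm \<rho> M y"
      using \<rho> by (intro mult_left_mono deriv_sum_le_trunc_norm sum_nonneg) auto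
    finally show "(\<Sum>m\<in>?S. \<rho> ^ (mdeg m - 1) * norm (mfps_nth (h \<alpha> * ?d) m))
        \<le> (\<Sum>k\<in>?k. \<rho> ^ (mdeg k - 1) * norm (mfps_nth (H $ \<alpha>) k)) * trunc_norm \<rho> M y" .
  qed simp
  finally show ?thesis by (simp add: sum_distrib_right)
qed

lemma sum_union_le:
  fixes f :: "'a \<Rightarrow> real"
  assumes "finite A" "finite B" "\<And>x. 0 \<le> f x"
  shows "sum f (A \<union> B) \<le> sum f A + sum f B"
  using assms sum.union_inter[of A B f] sum_nonneg[of "A \<inter> B" f] by auto

text \<open>The analytic core, a Briot--Bouquet theorem in several variables: if the derivatives of finitely many
  series along a vector field with the linear part of the radial field are dominated by these
  series, then the series converge. Let \<open>S\<close> be the total norm of the parts of degree above \<open>K\<close>. As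
  long as \<open>S \<le> 1\<close>, all norms are at most a constant \<open>B\<close> that does not involve \<open>K\<close>, and the tail
  estimate gives \<open>S \<le> const / K + small\<close>. Choosing first \<open>K\<close> large and then the radius small,
  \<open>S \<le> 1\<close> implies \<open>S \<le> 1/2\<close>. Since \<open>S\<close> is continuous in the radius and zero at radius zero, it can
  never leave the interval up to \<open>1/2\<close>. The finitely many
  degrees at which the linearized recursion could degenerate lie below \<open>K\<close>, where the given
  series are used as they are.\<close>

lemma bounded_of_dominated_system:
  fixes H :: "(complex, 'n::finite) mfps ^ 'n"
  assumes fin: "finite Y"
    and H0: "\<And>\<alpha>. mfps_nth (H $ \<alpha>) 0 = 0"
    and H1: "\<And>\<alpha> \<beta>. mfps_nth (H $ \<alpha>) (axis \<beta> 1) = (if \<alpha> = \<beta> then 1 else 0)"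
    and dom_H: "\<And>\<alpha>. dominated Y (H $ \<alpha>)"
    and dom_Y: "\<And>y. y \<in> Y \<Longrightarrow> dominated Y (field_apply H y)"
  obtains \<rho> B where "0 < \<rho>" "\<rho> \<le> 1/2" "\<And>M y. y \<in> Y \<Longrightarrow> trunc_norm \<rho> M y \<le> B"
proof -
  define b where "b = (\<Sum>y\<in>Y. \<Sum>m | mdeg m \<le> 1. norm (mfps_nth y m))"
  \<comment> \<open>one unit of slack for the degrees between 2 and \<open>K\<close>, one for the tail above \<open>K\<close>\<close>
  define B where "B = b + 2"
  define Z where "Z = field_apply H ` Y \<union> range (\<lambda>\<alpha>. H $ \<alpha>)"
  have finZ: "finite Z" using fin by (simp add: Z_def)
  have "\<forall>f\<in>Z. dominated Y f" using dom_H dom_Y by (auto simp: Z_def)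
  then have "\<forall>f\<in>Z. \<exists>G. \<forall>\<rho> M. 0 \<le> \<rho> \<longrightarrow> \<rho> \<le> 1/2 \<longrightarrow>
     (\<forall>y\<in>Y. trunc_norm \<rho> M y \<le> B) \<longrightarrow> trunc_norm \<rho> M f \<le> G"
    by (auto simp: dominated_def)
  then obtain g where g: "\<And>f \<rho> M. f \<in> Z \<Longrightarrow> 0 \<le> \<rho> \<Longrightarrow> \<rho> \<le> 1/2 \<Longrightarrow>
     (\<forall>y\<in>Y. trunc_norm \<rho> M y \<le> B) \<Longrightarrow> trunc_norm \<rho> M f \<le> g f"
    by metis
  define G where "G = (\<Sum>f\<in>Z. \<bar>g f\<bar>)"
  have G0: "0 \<le> G" unfolding G_def by (intro sum_nonneg) auto
  have G: "trunc_norm \<rho> M f \<le> G"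
    if "f \<in> Z" "0 \<le> \<rho>" "\<rho> \<le> 1/2" "\<forall>y\<in>Y. trunc_norm \<rho> M y \<le> B" for f \<rho> M
  proof -
    have "\<bar>g f\<bar> \<le> G" unfolding G_def using finZ that(1) by (intro member_le_sum) auto
    then show ?thesis using g[OF that] by linarith
  qed
  define n where "n = real CARD('n)"
  \<comment> \<open>the constant in the bound \<open>S \<le> c / K\<close> obtained below; it does not depend on \<open>K\<close>\<close>
  define c where "c = real (card Y) * (G + (1 + n * G) * B)"
  define K where "K = nat \<lceil>2 * c\<rceil> + 1"
  have K: "0 < K" and Kc: "c / K \<le> 1/2"
    by (simp add: K_def) (simp add: K_def field_simps, linarith)
  define \<phi>1 where "\<phi>1 = (\<Sum>y\<in>Y. \<Sum>m | 2 \<le> mdeg m \<and> mdeg m \<le> K. real (mdeg m) * norm (mfps_nth y m))"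
  define \<phi>2 where "\<phi>2 = (\<Sum>\<alpha>\<in>UNIV. \<Sum>m | 2 \<le> mdeg m \<and> mdeg m \<le> K. norm (mfps_nth (H $ \<alpha>) m))"
  have \<phi>0: "0 \<le> \<phi>1" "0 \<le> \<phi>2" unfolding \<phi>1_def \<phi>2_def by (intro sum_nonneg; simp)+
  \<comment> \<open>small enough to make the middle degrees of the unknowns at most 1 and those of \<open>H\<close> at most \<open>1 / K\<close>\<close>
  define \<rho>0 where "\<rho>0 = 1 / (2 * (1 + real K) * (1 + \<phi>1 + \<phi>2))"
  have den: "1 \<le> (1 + real K) * (1 + \<phi>1 + \<phi>2)" using \<phi>0 mult_mono[of 1 "1 + real K" 1 "1 + \<phi>1 + \<phi>2"] by simp
  have \<rho>0: "0 < \<rho>0" "\<rho>0 \<le> 1/2"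
    using den by (auto simp: \<rho>0_def field_simps intro!: divide_pos_pos mult_pos_pos)
  have \<rho>01: "\<rho>0 * \<phi>1 \<le> 1"
  proof -
    have "\<phi>1 \<le> 1 * (1 + \<phi>1 + \<phi>2)" using \<phi>0 by simp
    also have "\<dots> \<le> (2 * (1 + real K)) * (1 + \<phi>1 + \<phi>2)" using \<phi>0 by (intro mult_right_mono) auto
    finally show ?thesis using \<phi>0 by (simp add: \<rho>0_def divide_simps)
  qed
  have \<rho>02: "\<rho>0 * \<phi>2 \<le> 1 / K"
  proof -
    have "real K * \<phi>2 \<le> (2 * (1 + real K)) * (1 + \<phi>1 + \<phi>2)" using \<phi>0 by (intro mult_mono) auto
    then show ?thesis using \<phi>0 K by (simp add: \<rho>0_def divide_simps mult.commute)
  qed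
  define S where "S M \<rho> = (\<Sum>y\<in>Y. \<Sum>m | K < mdeg m \<and> mdeg m \<le> M. norm_weight \<rho> (mdeg m) * norm (mfps_nth y m))" for M \<rho>
  have S_nonneg: "0 \<le> S M \<rho>" if "0 \<le> \<rho>" for M \<rho>
    unfolding S_def using that by (intro sum_nonneg) auto
  have pow_le: "\<rho> ^ (k - 1) \<le> \<rho>0" if "0 \<le> \<rho>" "\<rho> \<le> \<rho>0" "2 \<le> k" for \<rho> :: real and k :: nat
  proof -
    have "\<rho> ^ (k - 1) \<le> \<rho> ^ 1" using that \<rho>0 by (intro power_decreasing) auto
    then show ?thesis using that by simp
  qed
  have T_le: "trunc_norm \<rho> M y \<le> B" if \<rho>: "0 \<le> \<rho>" "\<rho> \<le> \<rho>0" and S: "S M \<rho> \<le> 1" and y: "y \<in> Y" for \<rho> M y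
  proof -
    let ?f = "\<lambda>m. norm_weight \<rho> (mdeg m) * norm (mfps_nth y m)"
    let ?A1 = "{m :: nat ^ 'n. mdeg m \<le> 1}" and ?A2 = "{m :: nat ^ 'n. 2 \<le> mdeg m \<and> mdeg m \<le> K}"
    let ?A3 = "{m :: nat ^ 'n. K < mdeg m \<and> mdeg m \<le> M}"
    have nn: "0 \<le> ?f m" for m using \<rho> by simp
    have "trunc_norm \<rho> M y \<le> sum ?f (?A1 \<union> (?A2 \<union> ?A3))"
      unfolding trunc_norm_def using nn by (intro sum_mono2) auto
    also have "\<dots> \<le> sum ?f ?A1 + sum ?f (?A2 \<union> ?A3)"
      using nn by (intro sum_union_le) auto
    also have "sum ?f (?A2 \<union> ?A3) \<le> sum ?f ?A2 + sum ?f ?A3"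
      using nn by (intro sum_union_le) auto
    also have "sum ?f ?A1 \<le> b"
    proof -
      have "sum ?f ?A1 = (\<Sum>m\<in>?A1. norm (mfps_nth y m))"
      proof (rule sum.cong)
        fix m :: "nat ^ 'n" assume "m \<in> ?A1"
        then have "mdeg m \<le> 1" by simp
        then have "mdeg m = 0 \<or> mdeg m = 1" by linarith
        then show "?f m = norm (mfps_nth y m)" by (auto simp: norm_weight_def simp del: mdeg_eq_0_iff)
      qed simp
      also have "\<dots> \<le> b" unfolding b_def using fin y by (intro member_le_sum sum_nonneg) auto
      finally show ?thesis .
    qed
    also have "sum ?f ?A2 \<le> 1"
    proof -
      have "sum ?f ?A2 \<le> (\<Sum>m\<in>?A2. \<rho>0 * (real (mdeg m) * norm (mfps_nth y m)))"
      proof (rule sum_mono)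
        fix m :: "nat ^ 'n" assume m: "m \<in> ?A2"
        have "\<rho> ^ (mdeg m - 1) * (real (mdeg m) * norm (mfps_nth y m)) \<le> \<rho>0 * (real (mdeg m) * norm (mfps_nth y m))"
          using m pow_le[OF \<rho>] by (intro mult_right_mono) auto
        then show "?f m \<le> \<rho>0 * (real (mdeg m) * norm (mfps_nth y m))"
          using m by (auto simp: norm_weight_def mult_ac)
      qed
      also have "\<dots> = \<rho>0 * (\<Sum>m\<in>?A2. real (mdeg m) * norm (mfps_nth y m))"
        by (simp add: sum_distrib_left)
      also have "\<dots> \<le> \<rho>0 * \<phi>1"
        unfolding \<phi>1_def using \<rho>0 fin y by (intro mult_left_mono member_le_sum sum_nonneg) auto
      finally show ?thesis using \<rho>01 by linarith
    qed
    also have "sum ?f ?A3 \<le> S M \<rho>"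
      unfolding S_def using fin y nn \<rho> by (intro member_le_sum[where f = "\<lambda>y. \<Sum>m | K < mdeg m \<and> mdeg m \<le> M. norm_weight \<rho> (mdeg m) * norm (mfps_nth y m)"] sum_nonneg) auto
    finally show ?thesis using S by (simp add: B_def)
  qed
  have improve: "S M \<rho> \<le> 1/2" if \<rho>: "0 \<le> \<rho>" "\<rho> \<le> \<rho>0" and S: "S M \<rho> \<le> 1" for M \<rho>
  proof -
    have \<rho>h: "\<rho> \<le> 1/2" using \<rho> \<rho>0 by linarith
    have TB: "\<forall>y\<in>Y. trunc_norm \<rho> M y \<le> B" using T_le[OF \<rho> S] by blast
    let ?A = "{m :: nat ^ 'n. 2 \<le> mdeg m \<and> mdeg m \<le> M}"
    let ?A2 = "{m :: nat ^ 'n. 2 \<le> mdeg m \<and> mdeg m \<le> K}"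
    let ?A3 = "{m :: nat ^ 'n. K < mdeg m \<and> mdeg m \<le> M}"
    let ?h = "\<lambda>\<alpha> k. \<rho> ^ (mdeg k - 1) * norm (mfps_nth (H $ \<alpha>) k)"
    have "(\<Sum>\<alpha>\<in>UNIV. sum (?h \<alpha>) ?A) \<le> (\<Sum>\<alpha>\<in>UNIV. (\<Sum>k\<in>?A2. \<rho>0 * norm (mfps_nth (H $ \<alpha>) k)) + G / K)"
    proof (rule sum_mono)
      fix \<alpha> :: 'n
      have nn: "0 \<le> ?h \<alpha> m" for m using \<rho> by simp
      have "sum (?h \<alpha>) ?A \<le> sum (?h \<alpha>) (?A2 \<union> ?A3)"
        using nn by (intro sum_mono2) auto
      also have "\<dots> \<le> sum (?h \<alpha>) ?A2 + sum (?h \<alpha>) ?A3"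
        using nn by (intro sum_union_le) auto
      also have "sum (?h \<alpha>) ?A2 \<le> (\<Sum>k\<in>?A2. \<rho>0 * norm (mfps_nth (H $ \<alpha>) k))"
        using pow_le[OF \<rho>] by (intro sum_mono mult_right_mono) auto
      also have "sum (?h \<alpha>) ?A3 \<le> (\<Sum>k\<in>?A3. norm_weight \<rho> (mdeg k) * norm (mfps_nth (H $ \<alpha>) k) / K)"
      proof (rule sum_mono)
        fix k assume k: "k \<in> ?A3"
        have "real K * ?h \<alpha> k \<le> real (mdeg k) * ?h \<alpha> k"
          using k nn by (intro mult_right_mono) auto
        then show "?h \<alpha> k \<le> norm_weight \<rho> (mdeg k) * norm (mfps_nth (H $ \<alpha>) k) / K"
          using k K by (auto simp: norm_weight_def field_simps)
      qed
      also have "\<dots> = (\<Sum>k\<in>?A3. norm_weight \<rho> (mdeg k) * norm (mfps_nth (H $ \<alpha>) k)) / K"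
        by (simp add: sum_divide_distrib)
      also have "\<dots> \<le> trunc_norm \<rho> M (H $ \<alpha>) / K"
        unfolding trunc_norm_def using \<rho> by (intro divide_right_mono sum_mono2) auto
      also have "\<dots> \<le> G / K"
        using G[OF _ \<rho>(1) \<rho>h TB] by (intro divide_right_mono) (auto simp: Z_def)
      finally show "sum (?h \<alpha>) ?A \<le> (\<Sum>k\<in>?A2. \<rho>0 * norm (mfps_nth (H $ \<alpha>) k)) + G / K" by simp
    qed
    also have "\<dots> = \<rho>0 * \<phi>2 + n * G / K"
      by (simp add: sum.distrib \<phi>2_def sum_distrib_left n_def)
    also have "\<dots> \<le> 1 / K + n * G / K" using \<rho>02 by simp
    also have "\<dots> = (1 + n * G) / K" by (simp add: add_divide_distrib)
    finally have hb: "(\<Sum>\<alpha>\<in>UNIV. sum (?h \<alpha>) ?A) \<le> (1 + n * G) / K" .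
    have "S M \<rho> \<le> (\<Sum>y\<in>Y. G / K + (1 + n * G) / K * B)"
      unfolding S_def
    proof (rule sum_mono)
      fix y assume y: "y \<in> Y"
      have "(\<Sum>m\<in>?A3. norm_weight \<rho> (mdeg m) * norm (mfps_nth y m))
          \<le> trunc_norm \<rho> M (field_apply H y) / K + (\<Sum>\<alpha>\<in>UNIV. sum (?h \<alpha>) ?A) * trunc_norm \<rho> M y"
        by (rule tail_estimate[OF H0 H1 \<rho>(1) K])
      also have "\<dots> \<le> G / K + (1 + n * G) / K * B"
      proof (intro add_mono divide_right_mono mult_mono hb)
        show "trunc_norm \<rho> M (field_apply H y) \<le> G"
          using y by (intro G[OF _ \<rho>(1) \<rho>h TB]) (auto simp: Z_def)
        show "trunc_norm \<rho> M y \<le> B" using TB y by blast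
        show "0 \<le> (1 + n * G) / K" using G0 by (simp add: n_def)
      qed (use \<rho> in auto)
      finally show "(\<Sum>m\<in>?A3. norm_weight \<rho> (mdeg m) * norm (mfps_nth y m)) \<le> G / K + (1 + n * G) / K * B" .
    qed
    also have "\<dots> = real (card Y) * ((G + (1 + n * G) * B) / K)"
      by (simp only: sum_constant add_divide_distrib[of G] times_divide_eq_left)
    also have "\<dots> = c / K" by (simp add: c_def)
    finally show ?thesis using Kc by linarith
  qed
  have "S M \<rho>0 \<le> 1" for M
  proof (rule ccontr)
    assume "\<not> S M \<rho>0 \<le> 1"
    moreover have "S M 0 = 0"
    proof -
      have "norm_weight 0 (mdeg m) = 0" if "K < mdeg m" for m :: "nat ^ 'n"
        using that K by (auto simp: norm_weight_def)
      then show ?thesis unfolding S_def by (intro sum.neutral ballI) auto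
    qed
    moreover have "continuous_on {0..\<rho>0} (S M)"
    proof -
      have "continuous_on {0..\<rho>0} (\<lambda>\<rho>. norm_weight \<rho> k)" for k
        by (cases k) (auto simp: norm_weight_def intro!: continuous_intros)
      then show ?thesis unfolding S_def by (intro continuous_intros)
    qed
    ultimately obtain \<rho> where "0 \<le> \<rho>" "\<rho> \<le> \<rho>0" "S M \<rho> = 1"
      using IVT'[of "S M" 0 1 \<rho>0] \<rho>0 by auto
    then show False using improve[of \<rho> M] by simp
  qed
  then have "trunc_norm \<rho>0 M y \<le> B" if "y \<in> Y" for M y
    using T_le[of \<rho>0 M y] that \<rho>0 by simp
  then show thesis using that \<rho>0 by blast
qed

section \<open>Lifting solutions from the origin to formal power series\<close>

definition ord_ge :: "nat \<Rightarrow> (complex, 'n::finite) mfps \<Rightarrow> bool" where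
  "ord_ge k f \<longleftrightarrow> (\<forall>m. mdeg m < k \<longrightarrow> mfps_nth f m = 0)"

lemma ord_ge_0 [simp]: "ord_ge 0 f" "ord_ge k 0"
  by (auto simp: ord_ge_def)

lemma ord_ge_1_iff: "ord_ge (Suc 0) f \<longleftrightarrow> mfps_nth f 0 = 0"
  by (auto simp: ord_ge_def)

lemma ord_ge_add: "ord_ge k f \<Longrightarrow> ord_ge k g \<Longrightarrow> ord_ge k (f + g)"
  by (auto simp: ord_ge_def)

lemma ord_ge_diff: "ord_ge k f \<Longrightarrow> ord_ge k g \<Longrightarrow> ord_ge k (f - g)"
  by (auto simp: ord_ge_def)

lemma ord_ge_sum: "(\<And>i. i \<in> I \<Longrightarrow> ord_ge k (f i)) \<Longrightarrow> ord_ge k (\<Sum>i\<in>I. f i)"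
  by (auto simp: ord_ge_def)

lemma ord_ge_mult:
  fixes f g :: "(complex, 'n::finite) mfps"
  assumes "ord_ge k f" "ord_ge l g" shows "ord_ge (k + l) (f * g)"
  unfolding ord_ge_def
proof (intro allI impI)
  fix m :: "nat ^ 'n" assume m: "mdeg m < k + l"
  have "mfps_nth f a = 0 \<or> mfps_nth g b = 0" if "a + b = m" for a b
  proof -
    have "mdeg a + mdeg b < k + l" using m that by auto
    then have "mdeg a < k \<or> mdeg b < l" by linarith
    then show ?thesis using assms by (auto simp: ord_ge_def)
  qed
  then show "mfps_nth (f * g) m = 0"
    unfolding mfps_nth_mult by (intro sum.neutral) auto
qed

lemma ord_ge_mult_right: "ord_ge k f \<Longrightarrow> ord_ge k (f * g)"
  using ord_ge_mult[of k f 0 g] by simp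

lemma ord_ge_all_imp_0: "(\<And>k. ord_ge k f) \<Longrightarrow> f = 0"
  by (rule mfps_eqI) (auto simp: ord_ge_def)

definition vord :: "nat \<Rightarrow> (complex, 'n::finite) mfps ^ 'k \<Rightarrow> bool" where
  "vord k x \<longleftrightarrow> (\<forall>i. ord_ge k (x $ i))"

lemma vord_0 [simp]: "vord 0 x" "vord k 0"
  by (auto simp: vord_def)

lemma vord_add: "vord k x \<Longrightarrow> vord k y \<Longrightarrow> vord k (x + y)"
  by (auto simp: vord_def ord_ge_add)

lemma vord_diff: "vord k x \<Longrightarrow> vord k y \<Longrightarrow> vord k (x - y)"
  by (auto simp: vord_def ord_ge_diff)

lemma vord_uminus: "vord k x \<Longrightarrow> vord k (- x)"
  using vord_diff[of k 0 x] by simp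

lemma vord_mono: "vord k x \<Longrightarrow> j \<le> k \<Longrightarrow> vord j x"
  by (auto simp: vord_def ord_ge_def)

lemma vord_all_imp_0: "(\<And>k. vord k x) \<Longrightarrow> x = 0"
  by (auto simp: vord_def vec_eq_iff intro!: ord_ge_all_imp_0)

text \<open>Contraction principle for the topology given by the order of vanishing, restricted to the residue class
  of \<open>x0\<close>: the coefficients of the iterates in each degree eventually become constant.\<close>

lemma formal_fixpoint:
  fixes \<Phi> :: "(complex, 'n::finite) mfps ^ 'k \<Rightarrow> (complex, 'n) mfps ^ 'k"
  assumes near: "\<And>x. vord 1 (x - x0) \<Longrightarrow> vord 1 (\<Phi> x - x0)"
    and contr: "\<And>k x y. vord 1 (x - x0) \<Longrightarrow> vord 1 (y - x0) \<Longrightarrow> vord k (x - y)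
      \<Longrightarrow> vord (Suc k) (\<Phi> x - \<Phi> y)"
  obtains x where "\<Phi> x = x" "vord 1 (x - x0)"
proof -
  define s where "s j = (\<Phi> ^^ j) x0" for j
  have s_0: "s 0 = x0" and s_Suc: "s (Suc j) = \<Phi> (s j)" for j by (simp_all add: s_def)
  have s_near: "vord 1 (s j - x0)" for j
    by (induction j) (simp_all add: s_0 s_Suc near del: One_nat_def)
  have step: "vord j (s (Suc j) - s j)" for j
    by (induction j) (auto simp: s_Suc intro!: contr near s_near)
  have cum: "vord j (s (j + i) - s j)" for i j
  proof (induction i)
    case (Suc i)
    have "vord j (s (Suc (j + i)) - s (j + i))" using step[of "j + i"] by (rule vord_mono) simp
    from vord_add[OF this Suc] show ?case by simp
  qed simp
  define x where "x = (\<chi> i. Abs_mfps (\<lambda>m. mfps_nth (s (Suc (mdeg m)) $ i) m))"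
  have x_nth: "mfps_nth (x $ i) m = mfps_nth (s (Suc (mdeg m)) $ i) m" for i m
    by (simp add: x_def Abs_mfps_inverse)
  have close: "vord j (x - s j)" for j
    unfolding vord_def ord_ge_def
  proof (intro allI impI)
    fix i m assume m: "mdeg (m :: nat ^ 'n) < j"
    then obtain d where j: "j = Suc (mdeg m) + d" using less_iff_Suc_add by auto
    have "mfps_nth ((s j - s (Suc (mdeg m))) $ i) m = 0"
      using cum[of "Suc (mdeg m)" d] unfolding j vord_def ord_ge_def by blast
    then show "mfps_nth ((x - s j) $ i) m = 0" by (simp add: x_nth)
  qed
  have x_near: "vord 1 (x - x0)"
    using vord_add[OF close[of 1] s_near[of 1]] by simp
  have "vord k (\<Phi> x - x)" for k
  proof -
    have "vord k (\<Phi> x - s (Suc k))"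
      unfolding s_Suc using contr[OF x_near s_near close[of k]] by (rule vord_mono) simp
    moreover have "vord k (x - s (Suc k))" using close[of "Suc k"] by (rule vord_mono) simp
    ultimately show ?thesis using vord_diff[of k "\<Phi> x - s (Suc k)" "x - s (Suc k)"] by simp
  qed
  then have "\<Phi> x = x" using vord_all_imp_0[of "\<Phi> x - x"] by simp
  then show thesis using x_near that by blast
qed

lemma vord_matrix_vector_mult:
  fixes x :: "(complex, 'n::finite) mfps ^ 'k::finite"
  assumes "\<And>i j. ord_ge 1 (N $ i $ j)" "vord k x"
  shows "vord (Suc k) (N *v x)"
proof -
  have "ord_ge (Suc k) (N $ i $ j * x $ j)" for i j
    using ord_ge_mult[OF assms(1), of k "x $ j"] assms(2) by (simp add: vord_def)
  then show ?thesis by (auto simp: vord_def matrix_vector_mult_def intro!: ord_ge_sum)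
qed

text \<open>The iteration \<open>x \<mapsto> b - N x\<close> gains one order in each step, because \<open>N\<close> vanishes at the origin.\<close>

lemma unipotent_system_solvable:
  fixes N :: "(complex, 'n::finite) mfps ^ 'k::finite ^ 'k"
  assumes N: "\<And>i j. ord_ge 1 (N $ i $ j)"
  obtains x where "x + N *v x = b"
proof -
  have lin: "N *v (x - y) = N *v x - N *v y" for x y
    by (simp add: matrix_vector_mult_def vec_eq_iff sum_subtractf algebra_simps)
  obtain x where x: "b - N *v x = x"
  proof (rule formal_fixpoint[of b "\<lambda>x. b - N *v x"])
    fix x
    show "vord 1 (b - N *v x - b)"
      using vord_uminus[OF vord_matrix_vector_mult[OF N, of 0 x]] by simp
  next
    fix k and x y :: "(complex, 'n) mfps ^ 'k" assume "vord k (x - y)"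
    from vord_uminus[OF vord_matrix_vector_mult[OF N this]]
    show "vord (Suc k) (b - N *v x - (b - N *v y))" by (simp add: lin)
  qed blast
  then have "x + N *v x = b" by (metis diff_add_cancel)
  then show thesis by (rule that)
qed

lemma mfps_inverse_exists:
  fixes f :: "(complex, 'n::finite) mfps"
  assumes "mfps_nth f 0 \<noteq> 0"
  obtains g where "g * f = 1"
proof -
  let ?c = "mfps_const (1 / mfps_nth f 0) :: (complex, 'n) mfps"
  let ?N = "\<chi> i j. ?c * f - 1 :: (complex, 'n) mfps ^ 1 ^ 1"
  have "ord_ge 1 (?N $ i $ j)" for i j
    using assms by (simp add: ord_ge_1_iff)
  then obtain x where "x + ?N *v x = (\<chi> i. 1)" by (rule unipotent_system_solvable)
  then have "x $ 1 + (?c * f - 1) * x $ 1 = 1"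
    by (simp add: vec_eq_iff matrix_vector_mult_def sum_1)
  then have "(?c * x $ 1) * f = 1" by (simp add: algebra_simps)
  then show thesis by (rule that)
qed

text \<open>Multiplying by the constant inverse at the origin reduces to a matrix \<open>1 + N\<close> with \<open>N\<close> vanishing at
  the origin. The second conclusion lets the lemma be applied again to \<open>B\<close>, which is how a
  right inverse becomes two-sided.\<close>

lemma mfps_matrix_right_inverse:
  fixes A :: "(complex, 'n::finite) mfps ^ 'k::finite ^ 'k"
  assumes "invertible (\<chi> i j. mfps_nth (A $ i $ j) 0)"
  obtains B where "A ** B = mat 1" "invertible (\<chi> i j. mfps_nth (B $ i $ j) 0)"
proof -
  let ?A0 = "\<chi> i j. mfps_nth (A $ i $ j) 0"
  obtain B0 where B0: "?A0 ** B0 = mat 1" using assms by (auto simp: invertible_def)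
  let ?B0 = "(\<chi> i j. mfps_const (B0 $ i $ j)) :: (complex, 'n) mfps ^ 'k ^ 'k"
  define N where "N = A ** ?B0 - mat 1"
  have N: "ord_ge 1 (N $ i $ j)" for i j
  proof -
    have "(\<Sum>k\<in>UNIV. ?A0 $ i $ k * B0 $ k $ j) = (mat 1 :: complex ^ 'k ^ 'k) $ i $ j"
      unfolding B0[symmetric] by (simp add: matrix_matrix_mult_def)
    then show ?thesis
      by (simp add: ord_ge_1_iff N_def matrix_matrix_mult_def mat_def)
  qed
  have "\<exists>x. x + N *v x = axis j 1" for j
    using unipotent_system_solvable[OF N, of "axis j 1"] by blast
  then obtain x where x: "\<And>j. x j + N *v x j = axis j 1" by metis
  let ?X = "\<chi> i j. x j $ i"
  have "(A ** ?B0) ** ?X = mat 1"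
  proof -
    have A: "A ** ?B0 = mat 1 + N" by (simp add: N_def)
    have "((mat 1 + N) ** ?X) $ i $ j = (x j + N *v x j) $ i" for i j
      by (simp add: matrix_matrix_mult_def matrix_vector_mult_def mat_def distrib_right
            sum.distrib if_distrib[where f = "\<lambda>a. a * _"] cong: if_cong)
    then show ?thesis unfolding A by (simp add: x vec_eq_iff mat_def axis_def)
  qed
  then have AB: "A ** (?B0 ** ?X) = mat 1" by (simp add: matrix_mul_assoc)
  have "?A0 ** (\<chi> i j. mfps_nth ((?B0 ** ?X) $ i $ j) 0) = mat 1"
  proof -
    have "mfps_nth ((A ** (?B0 ** ?X)) $ i $ j) 0 = (mat 1 :: complex ^ 'k ^ 'k) $ i $ j" for i j
      unfolding AB by (simp add: mat_def)
    moreover have "mfps_nth ((A ** C) $ i $ j) 0 = (\<Sum>k\<in>UNIV. mfps_nth (A $ i $ k) 0 * mfps_nth (C $ k $ j) 0)" for C i j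
      by (simp add: matrix_matrix_mult_def)
    ultimately show ?thesis
      by (simp add: vec_eq_iff) (simp add: matrix_matrix_mult_def)
  qed
  then have "invertible (\<chi> i j. mfps_nth ((?B0 ** ?X) $ i $ j) 0)"
    unfolding invertible_def using matrix_left_right_inverse by blast
  then show thesis using AB that by blast
qed

lemma mfps_matrix_inverse:
  fixes A :: "(complex, 'n::finite) mfps ^ 'k::finite ^ 'k"
  assumes "invertible (\<chi> i j. mfps_nth (A $ i $ j) 0)"
  obtains B where "A ** B = mat 1" "B ** A = mat 1"
proof -
  obtain B where B: "A ** B = mat 1" "invertible (\<chi> i j. mfps_nth (B $ i $ j) 0)"
    using mfps_matrix_right_inverse[OF assms] .
  obtain C where C: "B ** C = mat 1" using mfps_matrix_right_inverse[OF B(2)] .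
  have "A = A ** (B ** C)" by (simp add: C)
  also have "\<dots> = C" by (simp add: matrix_mul_assoc B)
  finally show thesis using that B C by metis
qed

section \<open>Idempotents of a formal family of commutative algebras\<close>

definition alg_mult :: "('n \<Rightarrow> 'n \<Rightarrow> 'n \<Rightarrow> 'a) \<Rightarrow> 'a ^ 'n \<Rightarrow> 'a ^ 'n \<Rightarrow> 'a::comm_ring_1 ^ 'n::finite" where
  "alg_mult c x y = (\<chi> \<alpha>. \<Sum>\<beta>\<in>UNIV. \<Sum>\<gamma>\<in>UNIV. x $ \<beta> * y $ \<gamma> * c \<alpha> \<beta> \<gamma>)"

lemma alg_mult_linear:
  "alg_mult c (x + y) z = alg_mult c x z + alg_mult c y z"
  "alg_mult c (x - y) z = alg_mult c x z - alg_mult c y z"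
  "alg_mult c z (x + y) = alg_mult c z x + alg_mult c z y"
  "alg_mult c z (x - y) = alg_mult c z x - alg_mult c z y"
  by (simp_all add: alg_mult_def vec_eq_iff sum.distrib sum_subtractf algebra_simps)

lemma alg_mult_commute:
  assumes "\<And>\<alpha> \<beta> \<gamma>. c \<alpha> \<beta> \<gamma> = c \<alpha> \<gamma> \<beta>"
  shows "alg_mult c x y = alg_mult c y x"
proof -
  have "(\<Sum>\<beta>\<in>UNIV. \<Sum>\<gamma>\<in>UNIV. x $ \<beta> * y $ \<gamma> * c \<alpha> \<beta> \<gamma>)
      = (\<Sum>\<beta>\<in>UNIV. \<Sum>\<gamma>\<in>UNIV. y $ \<beta> * x $ \<gamma> * c \<alpha> \<beta> \<gamma>)" for \<alpha>
  proof (subst sum.swap, intro sum.cong refl)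
    fix i j
    show "x $ j * y $ i * c \<alpha> j i = y $ i * x $ j * c \<alpha> i j"
      by (simp add: assms[of \<alpha> j i] mult.commute)
  qed
  then show ?thesis by (simp add: alg_mult_def)
qed

lemma alg_mult_assoc:
  fixes c :: "'n::finite \<Rightarrow> 'n \<Rightarrow> 'n \<Rightarrow> 'a::comm_ring_1"
  assumes "\<And>\<alpha> \<mu> \<nu> \<gamma>. (\<Sum>\<beta>\<in>UNIV. c \<beta> \<mu> \<nu> * c \<alpha> \<beta> \<gamma>) = (\<Sum>\<beta>\<in>UNIV. c \<alpha> \<mu> \<beta> * c \<beta> \<nu> \<gamma>)"
  shows "alg_mult c (alg_mult c x y) z = alg_mult c x (alg_mult c y z)"
proof -
  have "(\<Sum>\<beta>\<in>UNIV. \<Sum>\<gamma>\<in>UNIV. \<Sum>\<mu>\<in>UNIV. \<Sum>\<nu>\<in>UNIV. x $ \<mu> * y $ \<nu> * z $ \<gamma> * (c \<beta> \<mu> \<nu> * c \<alpha> \<beta> \<gamma>))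
      = (\<Sum>\<mu>\<in>UNIV. \<Sum>\<nu>\<in>UNIV. \<Sum>\<gamma>\<in>UNIV. x $ \<mu> * y $ \<nu> * z $ \<gamma> * (\<Sum>\<beta>\<in>UNIV. c \<beta> \<mu> \<nu> * c \<alpha> \<beta> \<gamma>))" for \<alpha>
    unfolding sum_distrib_left sum.cartesian_product UNIV_Times_UNIV
    by (rule sum.reindex_bij_witness[of _ "\<lambda>(\<mu>, \<nu>, \<gamma>, \<beta>). (\<beta>, \<gamma>, \<mu>, \<nu>)" "\<lambda>(\<beta>, \<gamma>, \<mu>, \<nu>). (\<mu>, \<nu>, \<gamma>, \<beta>)"]) auto
  moreover have "(\<Sum>\<mu>\<in>UNIV. \<Sum>\<beta>\<in>UNIV. \<Sum>\<nu>\<in>UNIV. \<Sum>\<gamma>\<in>UNIV. x $ \<mu> * y $ \<nu> * z $ \<gamma> * (c \<alpha> \<mu> \<beta> * c \<beta> \<nu> \<gamma>))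
      = (\<Sum>\<mu>\<in>UNIV. \<Sum>\<nu>\<in>UNIV. \<Sum>\<gamma>\<in>UNIV. x $ \<mu> * y $ \<nu> * z $ \<gamma> * (\<Sum>\<beta>\<in>UNIV. c \<alpha> \<mu> \<beta> * c \<beta> \<nu> \<gamma>))" for \<alpha>
    unfolding sum_distrib_left sum.cartesian_product UNIV_Times_UNIV
    by (rule sum.reindex_bij_witness[of _ "\<lambda>(\<mu>, \<nu>, \<gamma>, \<beta>). (\<mu>, \<beta>, \<nu>, \<gamma>)" "\<lambda>(\<mu>, \<beta>, \<nu>, \<gamma>). (\<mu>, \<nu>, \<gamma>, \<beta>)"]) auto
  ultimately show ?thesis
    unfolding assms
    by (simp add: alg_mult_def vec_eq_iff sum_distrib_left sum_distrib_right mult_ac)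
qed

lemma vord_alg_mult:
  assumes "vord k x" "vord l y" shows "vord (k + l) (alg_mult c x y)"
  using assms
  by (auto simp: vord_def alg_mult_def intro!: ord_ge_sum ord_ge_mult_right[OF ord_ge_mult])

lemma vord_alg_mult_left: "vord k y \<Longrightarrow> vord k (alg_mult c x y)"
  using vord_alg_mult[of 0 x k y c] by simp

text \<open>Newton's method for the equation \<open>x \<circ> x = x\<close>. Its linearization at the constant vector \<open>\<pi>\<close> is
  \<open>M v = 2 \<pi> \<circ> v - v\<close>, which up to terms vanishing at the origin is an involution, hence its own
  inverse. So \<open>x \<mapsto> x - M (x \<circ> x - x)\<close> is a contraction, and a fixed point of it is an idempotent.\<close>

lemma lift_idempotent:
  fixes c :: "'n::finite \<Rightarrow> 'n \<Rightarrow> 'n \<Rightarrow> (complex, 'n) mfps" and \<pi> :: "complex ^ 'n"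
  assumes comm: "\<And>x y. alg_mult c x y = alg_mult c y x"
    and assoc: "\<And>x y z. alg_mult c (alg_mult c x y) z = alg_mult c x (alg_mult c y z)"
    and idem: "alg_mult (\<lambda>\<alpha> \<beta> \<gamma>. mfps_nth (c \<alpha> \<beta> \<gamma>) 0) \<pi> \<pi> = \<pi>"
  obtains x where "alg_mult c x x = x" "\<And>\<alpha>. mfps_nth (x $ \<alpha>) 0 = \<pi> $ \<alpha>"
proof -
  note lin = alg_mult_linear[of c]
  define x0 :: "(complex, 'n) mfps ^ 'n" where "x0 = (\<chi> \<alpha>. mfps_const (\<pi> $ \<alpha>))"
  define d where "d = alg_mult c x0 x0 - x0"
  have d: "vord 1 d"
    using idem by (simp add: vord_def ord_ge_1_iff d_def x0_def alg_mult_def vec_eq_iff)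
  define M where "M v = alg_mult c x0 v + alg_mult c x0 v - v" for v
  have M_add: "M (a + b) = M a + M b" for a b by (simp add: M_def lin)
  have vord_M: "vord k (M v)" if "vord k v" for k v
    unfolding M_def using that by (intro vord_add vord_diff vord_alg_mult_left)
  define q where "q v = alg_mult c d v + alg_mult c d v + alg_mult c d v + alg_mult c d v" for v
  have vord_q: "vord (Suc k) (q v)" if "vord k v" for k v
  proof -
    have "vord (Suc k) (alg_mult c d v)" using vord_alg_mult[OF d that, of c] by simp
    then show ?thesis unfolding q_def by (intro vord_add)
  qed
  have MM: "M (M v) = v + q v" for v
  proof -
    have "alg_mult c x0 (alg_mult c x0 v) = alg_mult c d v + alg_mult c x0 v"
      by (simp add: d_def lin assoc)
    then show ?thesis by (simp only: M_def q_def lin) (simp add: algebra_simps)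
  qed
  define \<Phi> where "\<Phi> x = x - M (alg_mult c x x - x)" for x
  obtain x where x: "\<Phi> x = x" "vord 1 (x - x0)"
  proof (rule formal_fixpoint[of x0 \<Phi>])
    fix x assume x: "vord 1 (x - x0)"
    have "alg_mult c x x - x = alg_mult c x (x - x0) + alg_mult c x0 (x - x0) + d - (x - x0)"
      using comm[of x x0] by (simp add: lin d_def)
    also have "vord 1 \<dots>" 
      by (rule vord_diff[OF vord_add[OF vord_add[OF vord_alg_mult_left[OF x] vord_alg_mult_left[OF x]] d] x])
    finally have "vord 1 (M (alg_mult c x x - x))" by (rule vord_M)
    from vord_diff[OF x this] show "vord 1 (\<Phi> x - x0)" by (simp add: \<Phi>_def algebra_simps)
  next
    fix k x y assume x: "vord 1 (x - x0)" and y: "vord 1 (y - x0)" and xy: "vord k (x - y)"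
    define e where "e = alg_mult c (x - x0) (x - y) + alg_mult c (y - x0) (x - y)"
    have e: "vord (Suc k) e"
      unfolding e_def using vord_alg_mult[OF x xy, of c] vord_alg_mult[OF y xy, of c] by (simp add: vord_add)
    have "(alg_mult c x x - x) - (alg_mult c y y - y) = M (x - y) + e"
      using comm[of x y] by (simp add: M_def e_def lin)
    then have "alg_mult c x x - x = (alg_mult c y y - y) + M (x - y) + e"
      by (simp only: diff_eq_eq add.commute add.left_commute)
    then have "M (alg_mult c x x - x) = M (alg_mult c y y - y) + M (M (x - y)) + M e"
      by (simp only: M_add)
    then have "\<Phi> x - \<Phi> y = - (q (x - y) + M e)" by (simp add: \<Phi>_def MM)
    also have "vord (Suc k) \<dots>" using vord_q[OF xy] vord_M[OF e] by (intro vord_uminus vord_add)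
    finally show "vord (Suc k) (\<Phi> x - \<Phi> y)" .
  qed blast
  define w where "w = alg_mult c x x - x"
  have "M w = 0" using x(1) by (simp add: \<Phi>_def w_def)
  then have "w + q w = 0" using MM[of w] by (simp add: M_def alg_mult_def vec_eq_iff)
  then have w: "w = - q w" by (simp add: eq_neg_iff_add_eq_0)
  have "vord k w" for k
  proof (induction k)
    case (Suc k) then show ?case by (subst w) (intro vord_uminus vord_q)
  qed simp
  then have "w = 0" by (rule vord_all_imp_0)
  moreover have "mfps_nth (x $ \<alpha>) 0 = \<pi> $ \<alpha>" for \<alpha>
    using x(2) by (simp add: vord_def ord_ge_1_iff x0_def)
  ultimately show thesis using that by (simp add: w_def)
qed

text \<open>An idempotent equals all its powers, whose orders of vanishing grow without bound.\<close>

lemma small_idempotent_eq_0: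
  assumes idem: "alg_mult c y y = y" and small: "vord 1 y"
  shows "y = 0"
proof -
  have "vord (Suc k) y" for k
  proof (induction k)
    case (Suc k) from vord_alg_mult[OF this small, of c] show ?case by (simp add: idem)
  qed (use small in simp)
  then have "vord k y" for k using vord_mono[of "Suc k" y k] by simp
  then show ?thesis by (rule vord_all_imp_0)
qed

text \<open>The columns of \<open>P\<close> are formal idempotents that extend those at the origin; products of different ones
  are idempotents that vanish at the origin, hence zero. Since the columns form a basis at the
  origin, \<open>P\<close> has an inverse \<open>\<Psi>\<close>, and the last conclusion says that multiplication by a
  coordinate vector field is diagonal in the idempotent basis with the entries of \<open>\<Psi>\<close> as
  eigenvalues.\<close>

lemma formal_idempotent_frame:
  fixes c :: "'n::finite \<Rightarrow> 'n \<Rightarrow> 'n \<Rightarrow> (complex, 'n) mfps" and \<pi> :: "'n \<Rightarrow> complex ^ 'n"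
  assumes comm: "\<And>x y. alg_mult c x y = alg_mult c y x"
    and assoc: "\<And>x y z. alg_mult c (alg_mult c x y) z = alg_mult c x (alg_mult c y z)"
    and idem: "\<And>i j. alg_mult (\<lambda>\<alpha> \<beta> \<gamma>. mfps_nth (c \<alpha> \<beta> \<gamma>) 0) (\<pi> i) (\<pi> j) = (if i = j then \<pi> i else 0)"
    and span: "vec.span (range \<pi>) = UNIV"
  obtains P \<Psi> :: "'n \<Rightarrow> 'n \<Rightarrow> (complex, 'n) mfps"
  where "\<And>i j. (\<Sum>\<alpha>\<in>UNIV. \<Psi> i \<alpha> * P \<alpha> j) = (if i = j then 1 else 0)"
    "\<And>\<alpha> \<beta>. (\<Sum>i\<in>UNIV. P \<alpha> i * \<Psi> i \<beta>) = (if \<alpha> = \<beta> then 1 else 0)"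
    "\<And>\<alpha> \<gamma> j. (\<Sum>\<beta>\<in>UNIV. c \<alpha> \<beta> \<gamma> * P \<beta> j) = \<Psi> j \<gamma> * P \<alpha> j"
proof -
  have "\<exists>x. alg_mult c x x = x \<and> (\<forall>\<alpha>. mfps_nth (x $ \<alpha>) 0 = \<pi> i $ \<alpha>)" for i
    using lift_idempotent[OF comm assoc, of "\<pi> i"] idem[of i i] by auto
  then obtain x where xx: "\<And>i. alg_mult c (x i) (x i) = x i"
    and x0: "\<And>i \<alpha>. mfps_nth (x i $ \<alpha>) 0 = \<pi> i $ \<alpha>" by metis
  have orth: "alg_mult c (x i) (x j) = 0" if "i \<noteq> j" for i j
  proof (rule small_idempotent_eq_0)
    show "alg_mult c (alg_mult c (x i) (x j)) (alg_mult c (x i) (x j)) = alg_mult c (x i) (x j)"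
    proof -
      have "alg_mult c (alg_mult c (x i) (x j)) (alg_mult c (x i) (x j))
          = alg_mult c (x i) (alg_mult c (x j) (alg_mult c (x i) (x j)))" by (rule assoc)
      also have "alg_mult c (x i) (x j) = alg_mult c (x j) (x i)" by (rule comm)
      also have "alg_mult c (x j) (alg_mult c (x j) (x i)) = alg_mult c (x j) (x i)"
        by (simp only: assoc[symmetric] xx)
      also have "alg_mult c (x j) (x i) = alg_mult c (x i) (x j)" by (rule comm)
      also have "alg_mult c (x i) (alg_mult c (x i) (x j)) = alg_mult c (x i) (x j)"
        by (simp only: assoc[symmetric] xx)
      finally show ?thesis .
    qed
    show "vord 1 (alg_mult c (x i) (x j))"
      using idem[of i j] that by (simp add: vord_def ord_ge_1_iff alg_mult_def vec_eq_iff x0)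
  qed
  let ?A = "\<chi> \<alpha> i. x i $ \<alpha>"
  have "columns (\<chi> \<alpha> i. \<pi> i $ \<alpha>) = range \<pi>"
    by (auto simp: columns_def column_def)
  then have "invertible (\<chi> \<alpha> i. \<pi> i $ \<alpha>)"
    using matrix_right_invertible_span_columns[of "\<chi> \<alpha> i. \<pi> i $ \<alpha>"] span
    by (metis invertible_def matrix_left_right_inverse)
  then have "invertible (\<chi> i j. mfps_nth (?A $ i $ j) 0)" by (simp add: x0)
  then obtain B where AB: "?A ** B = mat 1" and BA: "B ** ?A = mat 1"
    by (rule mfps_matrix_inverse)
  have PB: "(\<Sum>i\<in>UNIV. x i $ \<alpha> * B $ i $ \<beta>) = (if \<alpha> = \<beta> then 1 else 0)" for \<alpha> \<beta>
    using arg_cong[OF AB, of "\<lambda>C. C $ \<alpha> $ \<beta>"] by (simp add: matrix_matrix_mult_def mat_def)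
  have BP: "(\<Sum>\<alpha>\<in>UNIV. B $ i $ \<alpha> * x j $ \<alpha>) = (if i = j then 1 else 0)" for i j
    using arg_cong[OF BA, of "\<lambda>C. C $ i $ j"] by (simp add: matrix_matrix_mult_def mat_def)
  have "(\<Sum>\<beta>\<in>UNIV. c \<alpha> \<beta> \<gamma> * x j $ \<beta>) = B $ j $ \<gamma> * x j $ \<alpha>" for \<alpha> \<gamma> j
  proof -
    have "(\<Sum>\<beta>\<in>UNIV. c \<alpha> \<beta> \<gamma> * x j $ \<beta>) = (\<Sum>\<beta>\<in>UNIV. \<Sum>\<epsilon>\<in>UNIV. c \<alpha> \<beta> \<epsilon> * x j $ \<beta> * (if \<epsilon> = \<gamma> then 1 else 0))"
      by (simp add: if_distrib cong: if_cong)
    also have "\<dots> = (\<Sum>\<beta>\<in>UNIV. \<Sum>\<epsilon>\<in>UNIV. \<Sum>i\<in>UNIV. B $ i $ \<gamma> * (x j $ \<beta> * x i $ \<epsilon> * c \<alpha> \<beta> \<epsilon>))"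
      by (simp only: PB[symmetric] sum_distrib_left mult_ac)
    also have "\<dots> = (\<Sum>i\<in>UNIV. B $ i $ \<gamma> * alg_mult c (x j) (x i) $ \<alpha>)"
      unfolding alg_mult_def vec_lambda_beta sum_distrib_left
      by (subst (2) sum.swap, subst sum.swap, rule refl)
    also have "\<dots> = (\<Sum>i\<in>UNIV. if i = j then B $ j $ \<gamma> * x j $ \<alpha> else 0)"
      by (rule sum.cong) (auto simp: xx orth)
    finally show ?thesis by simp
  qed
  then show thesis using that[of "\<lambda>i \<alpha>. B $ i $ \<alpha>" "\<lambda>\<alpha> i. x i $ \<alpha>"] PB BP by simp
qed

section \<open>The canonical frame of a semisimple formal flat F-manifold\<close>

lemma sum_delta_simps:
  fixes f :: "'n::finite \<Rightarrow> 'a::comm_ring_1"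
  shows "(\<Sum>j\<in>UNIV. f j * (if i = j then 1 else 0)) = f i"
    "(\<Sum>j\<in>UNIV. f j * (if j = i then 1 else 0)) = f i"
    "(\<Sum>j\<in>UNIV. (if i = j then 1 else 0) * f j) = f i"
    "(\<Sum>j\<in>UNIV. (if j = i then 1 else 0) * f j) = f i"
  by (simp_all add: if_distrib[where f = "\<lambda>a. _ * a"] if_distrib[where f = "\<lambda>a. a * _"] cong: if_cong)

lemma sum_mult_assoc:
  fixes a :: "'m::finite \<Rightarrow> 'a::comm_ring_1"
  shows "(\<Sum>\<alpha>\<in>UNIV. a \<alpha> * (\<Sum>\<beta>\<in>UNIV. M \<alpha> \<beta> * b \<beta>)) = (\<Sum>\<beta>\<in>(UNIV :: 'k::finite set). (\<Sum>\<alpha>\<in>UNIV. a \<alpha> * M \<alpha> \<beta>) * b \<beta>)"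
  unfolding sum_distrib_left sum_distrib_right by (subst sum.swap) (simp add: mult.assoc)

text \<open>Among the monomials of lowest degree of \<open>X\<close> take one with the highest power of the variable \<open>\<beta>\<close>. In \<open>L X\<close>
  its product with the variable \<open>\<beta>\<close> arises in no other way.\<close>

lemma nonzero_linear_part_cancel:
  fixes L X :: "(complex, 'n::finite) mfps"
  assumes L0: "mfps_nth L 0 = 0" and L1: "mfps_nth L (axis \<beta> 1) \<noteq> 0" and LX: "L * X = 0"
  shows "X = 0"
proof (rule ccontr)
  assume "X \<noteq> 0"
  then have "\<exists>m. mfps_nth X m \<noteq> 0" by (metis mfps_eqI zero_mfps.rep_eq)
  define k where "k = (LEAST k. \<exists>m. mfps_nth X m \<noteq> 0 \<and> mdeg m = k)"
  have "\<exists>m. mfps_nth X m \<noteq> 0 \<and> mdeg m = k"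
    unfolding k_def by (rule LeastI_ex) (use \<open>\<exists>m. mfps_nth X m \<noteq> 0\<close> in blast)
  have low: "mfps_nth X m = 0" if "mdeg m < k" for m
    using not_less_Least[of "mdeg m" "\<lambda>k. \<exists>m. mfps_nth X m \<noteq> 0 \<and> mdeg m = k"] that k_def by blast
  let ?S = "{m. mfps_nth X m \<noteq> 0 \<and> mdeg m = k}"
  have fin: "finite ?S" by (rule finite_subset[OF _ finite_mdeg_le[of k]]) auto
  have ne: "?S \<noteq> {}" using \<open>\<exists>m. mfps_nth X m \<noteq> 0 \<and> mdeg m = k\<close> by blast
  obtain m where m: "m \<in> ?S" and mmax: "\<And>m'. m' \<in> ?S \<Longrightarrow> m' $ \<beta> \<le> m $ \<beta>"
  proof -
    have "finite ((\<lambda>m. m $ \<beta>) ` ?S)" "(\<lambda>m. m $ \<beta>) ` ?S \<noteq> {}" using fin ne by auto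
    from Max_in[OF this] obtain m where mS: "m \<in> ?S" and mM: "Max ((\<lambda>m. m $ \<beta>) ` ?S) = m $ \<beta>" by blast
    show thesis
    proof (rule that[OF mS])
      fix m' assume "m' \<in> ?S"
      then show "m' $ \<beta> \<le> m $ \<beta>" unfolding mM[symmetric] using fin by (intro Max_ge) auto
    qed
  qed
  let ?e = "axis \<beta> 1 :: nat ^ 'n"
  have "mfps_nth (L * X) (?e + m) = (\<Sum>(a, b) \<in> {(?e, m)}. mfps_nth L a * mfps_nth X b)"
    unfolding mfps_nth_mult
  proof (rule sum.mono_neutral_right)
    show "finite {(a, b). a + b = ?e + m}" by (rule finite_multiindex_decomp)
    show "\<forall>p\<in>{(a, b). a + b = ?e + m} - {(?e, m)}. (case p of (a, b) \<Rightarrow> mfps_nth L a * mfps_nth X b) = 0"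
    proof
      fix p assume p: "p \<in> {(a, b). a + b = ?e + m} - {(?e, m)}"
      obtain a b where p_eq: "p = (a, b)" by (cases p)
      have ab: "a + b = ?e + m" and ne: "(a, b) \<noteq> (?e, m)" using p p_eq by auto
      show "(case p of (a, b) \<Rightarrow> mfps_nth L a * mfps_nth X b) = 0"
      proof (rule ccontr)
        assume "(case p of (a, b) \<Rightarrow> mfps_nth L a * mfps_nth X b) \<noteq> 0"
        then have La: "mfps_nth L a \<noteq> 0" and Xb: "mfps_nth X b \<noteq> 0" by (auto simp: p_eq)
        have "mdeg a \<noteq> 0" using La L0 by auto
        moreover have "mdeg b \<ge> k" using low[of b] Xb by force
        moreover have "mdeg a + mdeg b = 1 + k"
          using arg_cong[OF ab, of mdeg] m by simp
        ultimately have "mdeg b = k" by linarith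
        then have "b $ \<beta> \<le> m $ \<beta>" using mmax Xb by blast
        moreover have "a $ \<beta> + b $ \<beta> = 1 + m $ \<beta>"
          using arg_cong[OF ab, of "\<lambda>v. v $ \<beta>"] by (simp add: axis_def)
        ultimately have "a $ \<beta> > 0" by linarith
        then obtain l where l: "a = l + ?e" using nonzero_index_split by blast
        have "mdeg a = 1" using \<open>mdeg a + mdeg b = 1 + k\<close> \<open>mdeg b = k\<close> by simp
        then have "l = 0" using l by simp
        then have "a = ?e" using l by simp
        then show False using ab ne by (simp add: axis_add_eq_iff)
      qed
    qed
  qed simp
  then show False using LX L1 m by simp
qed

text \<open>\<open>c\<close> are the structure functions, \<open>P\<close> has the idempotent vector fields as columns and \<open>\<Psi>\<close> is its inverse. The
  remaining assumptions are the flatness of the unit, the existence of a potential for \<open>c\<close>, and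
  quasi-homogeneity.\<close>

locale semisimple_frame =
  fixes c :: "'n::finite \<Rightarrow> 'n \<Rightarrow> 'n \<Rightarrow> (complex, 'n) mfps"
    and P \<Psi> :: "'n \<Rightarrow> 'n \<Rightarrow> (complex, 'n) mfps"
    and A q r :: "complex ^ 'n"
  assumes \<Psi>P: "(\<Sum>\<alpha>\<in>UNIV. \<Psi> i \<alpha> * P \<alpha> j) = (if i = j then 1 else 0)"
    and P\<Psi>: "(\<Sum>i\<in>UNIV. P \<alpha> i * \<Psi> i \<beta>) = (if \<alpha> = \<beta> then 1 else 0)"
    and eig: "(\<Sum>\<beta>\<in>UNIV. c \<alpha> \<beta> \<gamma> * P \<beta> j) = \<Psi> j \<gamma> * P \<alpha> j"
    and unit: "(\<Sum>\<mu>\<in>UNIV. mfps_const (A $ \<mu>) * c \<alpha> \<mu> \<beta>) = (if \<alpha> = \<beta> then 1 else 0)"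
    and closed: "mfps_deriv \<delta> (c \<alpha> \<beta> \<gamma>) = mfps_deriv \<gamma> (c \<alpha> \<beta> \<delta>)"
    and homog: "field_apply (euler_field q r) (c \<alpha> \<beta> \<gamma>)
      = mfps_const (q $ \<beta> + q $ \<gamma> - q $ \<alpha>) * c \<alpha> \<beta> \<gamma>"
begin

lemma structure_eq: "c \<alpha> \<beta> \<gamma> = (\<Sum>j\<in>UNIV. P \<alpha> j * \<Psi> j \<beta> * \<Psi> j \<gamma>)"
proof -
  have "c \<alpha> \<beta> \<gamma> = (\<Sum>\<epsilon>\<in>UNIV. c \<alpha> \<epsilon> \<gamma> * (\<Sum>j\<in>UNIV. P \<epsilon> j * \<Psi> j \<beta>))"
    by (simp add: P\<Psi> sum_delta_simps)
  also have "\<dots> = (\<Sum>j\<in>UNIV. P \<alpha> j * \<Psi> j \<beta> * \<Psi> j \<gamma>)"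
    unfolding sum_mult_assoc eig by (simp add: mult_ac)
  finally show ?thesis .
qed

lemma eig_dual: "(\<Sum>\<alpha>\<in>UNIV. \<Psi> i \<alpha> * c \<alpha> \<beta> \<gamma>) = \<Psi> i \<gamma> * \<Psi> i \<beta>"
  unfolding structure_eq mult.assoc sum_mult_assoc \<Psi>P sum_delta_simps by (rule mult.commute)

lemma sum_frame_eq_unit: "(\<Sum>j\<in>UNIV. P \<alpha> j) = mfps_const (A $ \<alpha>)"
proof -
  define a where "a i = (\<Sum>\<mu>\<in>UNIV. \<Psi> i \<mu> * mfps_const (A $ \<mu>))" for i
  have "\<Psi> i \<beta> * a i = \<Psi> i \<beta>" for i \<beta>
  proof -
    have "\<Psi> i \<beta> * a i = (\<Sum>\<mu>\<in>UNIV. (\<Sum>\<alpha>\<in>UNIV. \<Psi> i \<alpha> * c \<alpha> \<mu> \<beta>) * mfps_const (A $ \<mu>))"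
      by (simp add: eig_dual a_def sum_distrib_left mult_ac)
    also have "\<dots> = (\<Sum>\<alpha>\<in>UNIV. \<Psi> i \<alpha> * (\<Sum>\<mu>\<in>UNIV. mfps_const (A $ \<mu>) * c \<alpha> \<mu> \<beta>))"
      unfolding sum_mult_assoc[symmetric] by (simp add: mult_ac)
    also have "\<dots> = \<Psi> i \<beta>" by (simp add: unit sum_delta_simps)
    finally show ?thesis .
  qed
  then have "(\<Sum>\<beta>\<in>UNIV. \<Psi> i \<beta> * a i * P \<beta> i) = (\<Sum>\<beta>\<in>UNIV. \<Psi> i \<beta> * P \<beta> i)" for i
    by simp
  then have "a i * (\<Sum>\<beta>\<in>UNIV. \<Psi> i \<beta> * P \<beta> i) = (\<Sum>\<beta>\<in>UNIV. \<Psi> i \<beta> * P \<beta> i)" for i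
    by (simp only: sum_distrib_left mult_ac)
  then have "a i = 1" for i by (simp add: \<Psi>P)
  then have "(\<Sum>j\<in>UNIV. P \<alpha> j) = (\<Sum>j\<in>UNIV. P \<alpha> j * a j)" by simp
  also have "\<dots> = mfps_const (A $ \<alpha>)"
    unfolding a_def sum_mult_assoc P\<Psi> by (simp add: sum_delta_simps)
  finally show ?thesis .
qed

text \<open>The matrix of the derivative of the frame along \<open>d\<close> in terms of the frame.\<close>

definition W :: "((complex, 'n) mfps \<Rightarrow> (complex, 'n) mfps) \<Rightarrow> 'n \<Rightarrow> 'n \<Rightarrow> (complex, 'n) mfps" where
  "W d i j = (\<Sum>\<alpha>\<in>UNIV. \<Psi> i \<alpha> * d (P \<alpha> j))"

lemma derivation_P: "d (P \<alpha> j) = (\<Sum>i\<in>UNIV. P \<alpha> i * W d i j)"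
  unfolding W_def sum_mult_assoc P\<Psi> by (simp add: sum_delta_simps)

lemma derivation_\<Psi>:
  assumes d: "derivation d"
  shows "d (\<Psi> i \<beta>) = - (\<Sum>j\<in>UNIV. W d i j * \<Psi> j \<beta>)"
proof -
  have "(\<Sum>\<alpha>\<in>UNIV. d (\<Psi> i \<alpha>) * P \<alpha> j) = - W d i j" for j
  proof -
    have "0 = d (\<Sum>\<alpha>\<in>UNIV. \<Psi> i \<alpha> * P \<alpha> j)" by (simp add: \<Psi>P derivationD[OF d])
    also have "\<dots> = (\<Sum>\<alpha>\<in>UNIV. d (\<Psi> i \<alpha>) * P \<alpha> j) + W d i j"
      by (simp add: derivationD[OF d] sum.distrib W_def)
    finally show ?thesis by (simp add: eq_neg_iff_add_eq_0)
  qed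
  then have "- (\<Sum>j\<in>UNIV. W d i j * \<Psi> j \<beta>) = (\<Sum>j\<in>UNIV. (\<Sum>\<alpha>\<in>UNIV. d (\<Psi> i \<alpha>) * P \<alpha> j) * \<Psi> j \<beta>)"
    by (simp add: sum_negf)
  also have "\<dots> = d (\<Psi> i \<beta>)"
    unfolding sum_mult_assoc[symmetric] P\<Psi> by (simp add: sum_delta_simps)
  finally show ?thesis by simp
qed

text \<open>The idempotents add up to the unit, which is constant.\<close>

lemma W_row_sum:
  assumes d: "derivation d" shows "(\<Sum>j\<in>UNIV. W d i j) = 0"
proof -
  have "(\<Sum>j\<in>UNIV. W d i j) = (\<Sum>\<alpha>\<in>UNIV. \<Psi> i \<alpha> * d (\<Sum>j\<in>UNIV. P \<alpha> j))"
    unfolding W_def derivationD[OF d] sum_distrib_left by (rule sum.swap)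
  then show ?thesis by (simp add: sum_frame_eq_unit derivationD[OF d])
qed

text \<open>Differentiating the eigenvalue equation of a matrix \<open>M\<close> that is diagonal in the frame: in the frame,
  the derivative of \<open>M\<close> is the derivative of the eigenvalues plus a commutator with \<open>W\<close>. Applied to the
  multiplication operators and to the multiplication by the Euler field, it yields all
  identities of canonical coordinates.\<close>

lemma derivation_diagonalized:
  assumes d: "derivation d"
    and MP: "\<And>\<alpha> j. (\<Sum>\<beta>\<in>UNIV. M \<alpha> \<beta> * P \<beta> j) = ev j * P \<alpha> j"
    and \<Psi>M: "\<And>i \<beta>. (\<Sum>\<alpha>\<in>UNIV. \<Psi> i \<alpha> * M \<alpha> \<beta>) = ev i * \<Psi> i \<beta>"
  shows "(\<Sum>\<alpha>\<in>UNIV. \<Psi> i \<alpha> * (\<Sum>\<beta>\<in>UNIV. d (M \<alpha> \<beta>) * P \<beta> j))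
    = (if i = j then d (ev j) else 0) + (ev j - ev i) * W d i j"
proof -
  have 1: "(\<Sum>\<beta>\<in>UNIV. d (M \<alpha> \<beta>) * P \<beta> j) = d (ev j) * P \<alpha> j + ev j * d (P \<alpha> j) - (\<Sum>\<beta>\<in>UNIV. M \<alpha> \<beta> * d (P \<beta> j))" for \<alpha>
    using arg_cong[OF MP[of \<alpha> j], of d] by (simp add: derivationD[OF d] sum.distrib algebra_simps)
  have 2: "(\<Sum>\<alpha>\<in>UNIV. \<Psi> i \<alpha> * (\<Sum>\<beta>\<in>UNIV. M \<alpha> \<beta> * d (P \<beta> j))) = ev i * W d i j"
    unfolding sum_mult_assoc \<Psi>M by (simp add: W_def sum_distrib_left mult_ac)
  have "(\<Sum>\<alpha>\<in>UNIV. \<Psi> i \<alpha> * (\<Sum>\<beta>\<in>UNIV. d (M \<alpha> \<beta>) * P \<beta> j))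
      = d (ev j) * (\<Sum>\<alpha>\<in>UNIV. \<Psi> i \<alpha> * P \<alpha> j) + ev j * W d i j - ev i * W d i j"
    unfolding 1 2[symmetric] by (simp add: W_def sum_distrib_left sum.distrib sum_subtractf algebra_simps)
  then show ?thesis by (simp add: \<Psi>P left_diff_distrib)
qed

text \<open>Rotation coefficients: up to sign these are the Christoffel symbols of the flat connection in the
  idempotent frame.\<close>

definition g :: "'n \<Rightarrow> 'n \<Rightarrow> (complex, 'n) mfps" where
  "g i j = (if i = j then 0 else \<Sum>\<gamma>\<in>UNIV. W (mfps_deriv \<gamma>) i j * P \<gamma> j)"

lemma eig_diff_contract:
  assumes "i \<noteq> j" shows "(\<Sum>\<gamma>\<in>UNIV. (\<Psi> j \<gamma> - \<Psi> i \<gamma>) * P \<gamma> j) = 1"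
  using \<Psi>P[of j j] \<Psi>P[of i j] assms by (simp add: left_diff_distrib sum_subtractf)

text \<open>Because \<open>c\<close> has a potential, the derivatives of the multiplication operators are symmetric in the two
  directions. Off the diagonal this says that \<open>W\<close>, as a one-form, is proportional to
  \<open>\<Psi> j - \<Psi> i\<close>; the contraction with the \<open>j\<close>-th idempotent, where that form takes the value 1, gives
  the factor.\<close>

lemma W_offdiag:
  assumes "i \<noteq> j"
  shows "W (mfps_deriv \<delta>) i j = g i j * (\<Psi> j \<delta> - \<Psi> i \<delta>)"
proof -
  have *: "(\<Psi> j \<gamma> - \<Psi> i \<gamma>) * W (mfps_deriv \<delta>) i j = (\<Psi> j \<delta> - \<Psi> i \<delta>) * W (mfps_deriv \<gamma>) i j" for \<gamma>
  proof -
    have K: "(\<Sum>\<alpha>\<in>UNIV. \<Psi> i \<alpha> * (\<Sum>\<beta>\<in>UNIV. mfps_deriv \<delta> (c \<alpha> \<beta> \<gamma>) * P \<beta> j))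
        = (\<Psi> j \<gamma> - \<Psi> i \<gamma>) * W (mfps_deriv \<delta>) i j" for \<delta> \<gamma>
      using derivation_diagonalized[OF derivation_mfps_deriv eig eig_dual] assms by simp
    show ?thesis unfolding K[symmetric] by (simp only: closed[of \<delta> _ _ \<gamma>])
  qed
  have "W (mfps_deriv \<delta>) i j = (\<Sum>\<gamma>\<in>UNIV. (\<Psi> j \<gamma> - \<Psi> i \<gamma>) * P \<gamma> j) * W (mfps_deriv \<delta>) i j"
    by (simp add: eig_diff_contract[OF assms])
  also have "\<dots> = (\<Sum>\<gamma>\<in>UNIV. ((\<Psi> j \<gamma> - \<Psi> i \<gamma>) * W (mfps_deriv \<delta>) i j) * P \<gamma> j)"
    by (simp add: sum_distrib_left sum_distrib_right mult_ac)
  also have "\<dots> = g i j * (\<Psi> j \<delta> - \<Psi> i \<delta>)"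
    unfolding * using assms by (simp add: g_def sum_distrib_left mult_ac)
  finally show ?thesis .
qed

text \<open>The eigenvalues of the multiplication by the Euler field. By the lemma \<open>deriv_U\<close> they are canonical
  coordinates: their differentials are dual to the idempotents.\<close>

definition U :: "'n \<Rightarrow> (complex, 'n) mfps" where
  "U i = (\<Sum>\<gamma>\<in>UNIV. euler_field q r $ \<gamma> * \<Psi> i \<gamma>)"

text \<open>The operator \<open>\<mu>\<close> in the idempotent frame.\<close>

definition V :: "'n \<Rightarrow> 'n \<Rightarrow> (complex, 'n) mfps" where
  "V i j = (\<Sum>\<alpha>\<in>UNIV. \<Psi> i \<alpha> * (mfps_const (q $ \<alpha>) * P \<alpha> j))"

text \<open>For the matrix \<open>E\<circ>\<close> of the multiplication by the Euler field this reads
  \<open>d (E\<circ>) = C + [C, \<mu>]\<close>. It combines the symmetry of the derivatives of \<open>c\<close> with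
  quasi-homogeneity.\<close>

lemma deriv_euler_matrix:
  "mfps_deriv \<gamma> (\<Sum>\<epsilon>\<in>UNIV. euler_field q r $ \<epsilon> * c \<alpha> \<beta> \<epsilon>) = mfps_const (1 + q $ \<beta> - q $ \<alpha>) * c \<alpha> \<beta> \<gamma>"
proof -
  have E: "mfps_deriv \<gamma> (euler_field q r $ \<epsilon>) = mfps_const (1 - q $ \<gamma>) * (if \<gamma> = \<epsilon> then 1 else 0)" for \<epsilon>
    by (auto simp: euler_field_def mfps_deriv_rules mfps_deriv_var)
  have "mfps_deriv \<gamma> (\<Sum>\<epsilon>\<in>UNIV. euler_field q r $ \<epsilon> * c \<alpha> \<beta> \<epsilon>)
      = mfps_const (1 - q $ \<gamma>) * (\<Sum>\<epsilon>\<in>UNIV. (if \<gamma> = \<epsilon> then 1 else 0) * c \<alpha> \<beta> \<epsilon>) + field_apply (euler_field q r) (c \<alpha> \<beta> \<gamma>)"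
    by (simp add: mfps_deriv_rules E sum.distrib field_apply_def closed[of \<gamma>] sum_distrib_left mult.assoc)
  also have "\<dots> = mfps_const (1 + q $ \<beta> - q $ \<alpha>) * c \<alpha> \<beta> \<gamma>"
    unfolding homog sum_delta_simps by (simp add: mfps_const_simps algebra_simps)
  finally show ?thesis .
qed

text \<open>The previous identity in the idempotent frame. Its diagonal shows that \<open>U\<close> are canonical coordinates,
  and its off-diagonal part that \<open>V\<close> is divisible by the differences of the \<open>U\<close>, also where
  these vanish at the origin.\<close>

lemma euler_frame_identity:
  "(if i = j then mfps_deriv \<gamma> (U j) else 0) + (U j - U i) * W (mfps_deriv \<gamma>) i j
    = (if i = j then \<Psi> j \<gamma> else 0) + (\<Psi> i \<gamma> - \<Psi> j \<gamma>) * V i j"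
proof -
  let ?M = "\<lambda>\<alpha> \<beta>. \<Sum>\<epsilon>\<in>UNIV. euler_field q r $ \<epsilon> * c \<alpha> \<beta> \<epsilon>"
  have MP: "(\<Sum>\<beta>\<in>UNIV. ?M \<alpha> \<beta> * P \<beta> j) = U j * P \<alpha> j" for \<alpha> j
  proof -
    have "(\<Sum>\<beta>\<in>UNIV. ?M \<alpha> \<beta> * P \<beta> j) = (\<Sum>\<epsilon>\<in>UNIV. euler_field q r $ \<epsilon> * (\<Sum>\<beta>\<in>UNIV. c \<alpha> \<beta> \<epsilon> * P \<beta> j))"
      unfolding sum_mult_assoc ..
    then show ?thesis by (simp add: eig U_def sum_distrib_right mult.assoc)
  qed
  have \<Psi>M: "(\<Sum>\<alpha>\<in>UNIV. \<Psi> i \<alpha> * ?M \<alpha> \<beta>) = U i * \<Psi> i \<beta>" for i \<beta>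
  proof -
    have "(\<Sum>\<alpha>\<in>UNIV. \<Psi> i \<alpha> * ?M \<alpha> \<beta>) = (\<Sum>\<epsilon>\<in>UNIV. (\<Sum>\<alpha>\<in>UNIV. \<Psi> i \<alpha> * c \<alpha> \<beta> \<epsilon>) * euler_field q r $ \<epsilon>)"
      unfolding sum_mult_assoc[symmetric] by (simp add: mult.commute)
    then show ?thesis by (simp add: eig_dual U_def sum_distrib_left mult_ac)
  qed
  have "(\<Sum>\<alpha>\<in>UNIV. \<Psi> i \<alpha> * (\<Sum>\<beta>\<in>UNIV. mfps_deriv \<gamma> (?M \<alpha> \<beta>) * P \<beta> j))
      = (\<Sum>\<alpha>\<in>UNIV. \<Psi> i \<alpha> * (\<Sum>\<beta>\<in>UNIV. c \<alpha> \<beta> \<gamma> * P \<beta> j))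
        + (\<Sum>\<alpha>\<in>UNIV. \<Psi> i \<alpha> * (\<Sum>\<beta>\<in>UNIV. c \<alpha> \<beta> \<gamma> * (mfps_const (q $ \<beta>) * P \<beta> j)))
        - (\<Sum>\<alpha>\<in>UNIV. \<Psi> i \<alpha> * (mfps_const (q $ \<alpha>) * (\<Sum>\<beta>\<in>UNIV. c \<alpha> \<beta> \<gamma> * P \<beta> j)))"
    unfolding deriv_euler_matrix
    by (simp add: mfps_const_simps sum.distrib sum_subtractf sum_distrib_left algebra_simps)
  also have "(\<Sum>\<alpha>\<in>UNIV. \<Psi> i \<alpha> * (\<Sum>\<beta>\<in>UNIV. c \<alpha> \<beta> \<gamma> * P \<beta> j)) = (if i = j then \<Psi> j \<gamma> else 0)"
    using \<Psi>P[of i j] unfolding eig by (simp add: mult.left_commute[of _ "\<Psi> j \<gamma>"] flip: sum_distrib_left)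
  also have "(\<Sum>\<alpha>\<in>UNIV. \<Psi> i \<alpha> * (\<Sum>\<beta>\<in>UNIV. c \<alpha> \<beta> \<gamma> * (mfps_const (q $ \<beta>) * P \<beta> j))) = \<Psi> i \<gamma> * V i j"
    unfolding sum_mult_assoc eig_dual V_def by (simp add: sum_distrib_left mult.assoc)
  also have "(\<Sum>\<alpha>\<in>UNIV. \<Psi> i \<alpha> * (mfps_const (q $ \<alpha>) * (\<Sum>\<beta>\<in>UNIV. c \<alpha> \<beta> \<gamma> * P \<beta> j))) = \<Psi> j \<gamma> * V i j"
    unfolding eig V_def by (simp add: sum_distrib_left mult_ac)
  finally show ?thesis
    unfolding derivation_diagonalized[OF derivation_mfps_deriv MP \<Psi>M] by (simp add: algebra_simps)
qed

lemma deriv_U: "mfps_deriv \<gamma> (U j) = \<Psi> j \<gamma>"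
  using euler_frame_identity[of j j \<gamma>] by simp

lemma V_offdiag:
  assumes "i \<noteq> j" shows "V i j = (U i - U j) * g i j"
proof -
  have "(\<Psi> j \<gamma> - \<Psi> i \<gamma>) * V i j = (\<Psi> j \<gamma> - \<Psi> i \<gamma>) * ((U i - U j) * g i j)" for \<gamma>
    using euler_frame_identity[of i j \<gamma>] assms by (simp add: W_offdiag[OF assms] algebra_simps)
  then have "(\<Sum>\<gamma>\<in>UNIV. P \<gamma> j * ((\<Psi> j \<gamma> - \<Psi> i \<gamma>) * V i j))
      = (\<Sum>\<gamma>\<in>UNIV. P \<gamma> j * ((\<Psi> j \<gamma> - \<Psi> i \<gamma>) * ((U i - U j) * g i j)))" by (simp only:)
  then have "(\<Sum>\<gamma>\<in>UNIV. (\<Psi> j \<gamma> - \<Psi> i \<gamma>) * P \<gamma> j) * V i j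
      = (\<Sum>\<gamma>\<in>UNIV. (\<Psi> j \<gamma> - \<Psi> i \<gamma>) * P \<gamma> j) * ((U i - U j) * g i j)"
    by (simp only: sum_distrib_left sum_distrib_right mult_ac)
  then show ?thesis by (simp add: eig_diff_contract[OF assms])
qed

lemma derivation_V:
  assumes d: "derivation d"
  shows "d (V i j) = (\<Sum>k\<in>UNIV. V i k * W d k j - W d i k * V k j)"
proof -
  have "d (V i j) = (\<Sum>\<alpha>\<in>UNIV. d (\<Psi> i \<alpha>) * (mfps_const (q $ \<alpha>) * P \<alpha> j)) + (\<Sum>\<alpha>\<in>UNIV. \<Psi> i \<alpha> * (mfps_const (q $ \<alpha>) * d (P \<alpha> j)))"
    by (simp add: V_def derivationD[OF d] sum.distrib)
  also have "(\<Sum>\<alpha>\<in>UNIV. d (\<Psi> i \<alpha>) * (mfps_const (q $ \<alpha>) * P \<alpha> j)) = - (\<Sum>k\<in>UNIV. W d i k * V k j)"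
    unfolding V_def sum_mult_assoc derivation_\<Psi>[OF d] by (simp add: sum_negf)
  also have "(\<Sum>\<alpha>\<in>UNIV. \<Psi> i \<alpha> * (mfps_const (q $ \<alpha>) * d (P \<alpha> j)))
      = (\<Sum>\<alpha>\<in>UNIV. (\<Psi> i \<alpha> * mfps_const (q $ \<alpha>)) * (\<Sum>k\<in>UNIV. P \<alpha> k * W d k j))"
    by (simp only: derivation_P[of d _ j] mult.assoc)
  also have "\<dots> = (\<Sum>k\<in>UNIV. V i k * W d k j)"
    unfolding sum_mult_assoc by (simp only: V_def mult.assoc)
  finally show ?thesis by (simp add: sum_subtractf)
qed

end

context semisimple_frame
begin

section \<open>The radial field in canonical coordinates\<close>

definition u :: "'n \<Rightarrow> complex" where "u i = mfps_nth (U i) 0"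

text \<open>Canonical coordinates centred at the origin.\<close>

definition v :: "'n \<Rightarrow> (complex, 'n) mfps" where "v i = U i - mfps_const (u i)"

text \<open>The radial field of the canonical coordinates \<open>v\<close>, written in the flat coordinates. Working with this
  field avoids any formal change of coordinates; in flat coordinates it agrees with the
  radial field only up to second order.\<close>

definition H :: "(complex, 'n) mfps ^ 'n" where "H = (\<chi> \<alpha>. \<Sum>k\<in>UNIV. P \<alpha> k * v k)"

abbreviation D :: "(complex, 'n) mfps \<Rightarrow> (complex, 'n) mfps" where "D \<equiv> field_apply H"

text \<open>The matrix \<open>W\<close> along \<open>H\<close>, as a polynomial in \<open>g\<close> and \<open>v\<close>; the diagonal comes from the vanishing row
  sums.\<close>

definition w :: "'n \<Rightarrow> 'n \<Rightarrow> (complex, 'n) mfps" where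
  "w i j = (if i = j then - (\<Sum>k\<in>UNIV - {i}. g i k * (v k - v i)) else g i j * (v j - v i))"

lemma deriv_v: "mfps_deriv \<gamma> (v i) = \<Psi> i \<gamma>"
  by (simp add: v_def mfps_deriv_rules deriv_U)

lemma v_at_0: "mfps_nth (v i) 0 = 0"
  by (simp add: v_def u_def)

lemma H_contract: "(\<Sum>\<gamma>\<in>UNIV. H $ \<gamma> * \<Psi> i \<gamma>) = v i"
proof -
  have "(\<Sum>\<gamma>\<in>UNIV. H $ \<gamma> * \<Psi> i \<gamma>) = (\<Sum>\<gamma>\<in>UNIV. \<Psi> i \<gamma> * (\<Sum>k\<in>UNIV. P \<gamma> k * v k))"
    by (simp add: H_def mult.commute)
  then show ?thesis by (simp add: sum_mult_assoc \<Psi>P sum_delta_simps)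
qed

lemma D_v: "D (v i) = v i"
  using H_contract by (simp add: field_apply_def deriv_v)

lemma nth_axis_eq: "mfps_nth f (axis \<beta> 1) = mfps_nth (mfps_deriv \<beta> f) 0"
  for f :: "(complex, 'n) mfps"
  by simp

lemma H_at_0: "mfps_nth (H $ \<alpha>) 0 = 0"
  by (simp add: H_def v_at_0)

lemma H_linear_part: "mfps_nth (H $ \<alpha>) (axis \<beta> 1) = (if \<alpha> = \<beta> then 1 else 0)"
proof -
  have "mfps_nth (H $ \<alpha>) (axis \<beta> 1) = mfps_nth (\<Sum>k\<in>UNIV. P \<alpha> k * \<Psi> k \<beta>) 0"
    unfolding nth_axis_eq by (simp add: H_def mfps_deriv_rules deriv_v v_at_0 del: mfps_deriv.rep_eq)
  then show ?thesis by (simp add: P\<Psi>)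
qed

lemma W_D: "W D i j = w i j"
proof -
  have off: "W D i j = g i j * (v j - v i)" if "i \<noteq> j" for j
  proof -
    have "W D i j = (\<Sum>\<gamma>\<in>UNIV. H $ \<gamma> * W (mfps_deriv \<gamma>) i j)"
      unfolding W_def field_apply_def sum_distrib_left by (subst sum.swap) (simp add: mult_ac)
    also have "\<dots> = g i j * ((\<Sum>\<gamma>\<in>UNIV. H $ \<gamma> * \<Psi> j \<gamma>) - (\<Sum>\<gamma>\<in>UNIV. H $ \<gamma> * \<Psi> i \<gamma>))"
      by (simp add: W_offdiag[OF that] sum_distrib_left sum_subtractf algebra_simps)
    finally show ?thesis by (simp add: H_contract)
  qed
  show ?thesis
  proof (cases "i = j")
    case True
    have "W D i i + (\<Sum>k\<in>UNIV - {i}. W D i k) = 0"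
      using W_row_sum[OF derivation_field_apply[of H], of i] by (simp add: sum.remove)
    moreover have "(\<Sum>k\<in>UNIV - {i}. W D i k) = (\<Sum>k\<in>UNIV - {i}. g i k * (v k - v i))"
      by (rule sum.cong) (auto simp: off)
    ultimately show ?thesis using True by (simp add: w_def eq_neg_iff_add_eq_0)
  qed (simp add: off w_def)
qed

lemma D_P: "D (P \<alpha> j) = (\<Sum>i\<in>UNIV. P \<alpha> i * w i j)"
  using derivation_P[of D] by (simp add: W_D)

lemma D_\<Psi>: "D (\<Psi> i \<beta>) = - (\<Sum>j\<in>UNIV. w i j * \<Psi> j \<beta>)"
  using derivation_\<Psi>[OF derivation_field_apply, of H] by (simp add: W_D)

lemma D_V: "D (V i j) = (\<Sum>k\<in>UNIV. V i k * w k j - w i k * V k j)"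
  using derivation_V[OF derivation_field_apply, of H] by (simp add: W_D)

lemma v_diff_cancel:
  assumes "i \<noteq> j" "(v i - v j) * X = 0" shows "X = 0"
proof -
  have "\<exists>\<beta>. mfps_nth (v i - v j) (axis \<beta> 1) \<noteq> 0"
  proof (rule ccontr)
    assume "\<not> ?thesis"
    then have "mfps_nth (\<Psi> j \<beta> - \<Psi> i \<beta>) 0 = 0" for \<beta>
      unfolding nth_axis_eq by (simp add: mfps_deriv_rules deriv_v del: mfps_deriv.rep_eq)
    then have "mfps_nth (\<Sum>\<beta>\<in>UNIV. (\<Psi> j \<beta> - \<Psi> i \<beta>) * P \<beta> j) 0 = 0"
      by (simp del: minus_mfps.rep_eq)
    then show False by (simp add: eig_diff_contract[OF assms(1)])
  qed
  then show ?thesis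
    using nonzero_linear_part_cancel[OF _ _ assms(2)] by (auto simp: v_at_0)
qed

text \<open>The decisive case. Here \<open>V i j = (v i - v j) * g i j\<close>, and the difference \<open>v i - v j\<close> vanishes at the origin,
  so \<open>g\<close> is not simply a quotient. But differentiating along \<open>H\<close> reproduces the factor,
  \<open>D (v i - v j) = v i - v j\<close>, and each term of the commutator \<open>[V, w]\<close> also contains it, because
  \<open>u i - u k\<close> and \<open>u j - u k\<close> agree. Cancelling the factor leaves a polynomial equation for \<open>D (g i j)\<close>.\<close>

lemma D_g_coalescing:
  assumes ij: "i \<noteq> j" and u: "u i = u j"
  shows "D (g i j) = g i j * (w j j - w i i) - (V i i - V j j) * g i j
    - (\<Sum>k\<in>UNIV - {i, j}. g i k * g k j * mfps_const (u i - u k)) - g i j"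
proof -
  define L where "L = v i - v j"
  have U_diff: "U a - U b = v a - v b + mfps_const (u a - u b)" for a b
    by (simp add: v_def mfps_const_simps)
  have Vij: "V i j = L * g i j"
    unfolding V_offdiag[OF ij] by (simp add: U_diff u L_def mfps_const_simps)
  let ?t = "\<lambda>k. V i k * w k j - w i k * V k j"
  have mid: "?t k = L * (- (g i k * g k j * mfps_const (u i - u k)))" if "k \<in> UNIV - {i, j}" for k
  proof -
    have k: "i \<noteq> k" "k \<noteq> j" using that by auto
    show ?thesis
      unfolding V_offdiag[OF k(1)] V_offdiag[OF k(2)] w_def U_diff L_def
      using k u by (simp add: mfps_const_simps algebra_simps)
  qed
  have "D (V i j) = ?t i + (?t j + (\<Sum>k\<in>UNIV - {i, j}. ?t k))"
    unfolding D_V using ij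
    by (subst sum.remove[of UNIV i], simp, simp, subst sum.remove[of "UNIV - {i}" j])
       (auto simp: Diff_insert2[symmetric] insert_commute)
  also have "(\<Sum>k\<in>UNIV - {i, j}. ?t k) = L * (- (\<Sum>k\<in>UNIV - {i, j}. g i k * g k j * mfps_const (u i - u k)))"
    using mid by (simp add: sum_distrib_left sum_negf)
  also have "?t i + (?t j + \<dots>) = L * (g i j * (w j j - w i i) - (V i i - V j j) * g i j
      - (\<Sum>k\<in>UNIV - {i, j}. g i k * g k j * mfps_const (u i - u k)))"
    unfolding Vij using ij by (simp add: w_def[of i j] L_def algebra_simps)
  finally have "L * (D (g i j) - (g i j * (w j j - w i i) - (V i i - V j j) * g i j
      - (\<Sum>k\<in>UNIV - {i, j}. g i k * g k j * mfps_const (u i - u k)) - g i j)) = 0"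
    unfolding Vij by (simp add: field_apply_rules D_v L_def algebra_simps)
  from v_diff_cancel[OF ij this[unfolded L_def]] show ?thesis by simp
qed

text \<open>The inverse of the difference of two eigenvalues that are different at the origin, used as an
  additional unknown so that all equations stay polynomial. The value 0 in the other case
  satisfies the same differential equation.\<close>

definition R :: "'n \<Rightarrow> 'n \<Rightarrow> (complex, 'n) mfps" where
  "R i j = (if u i = u j then 0 else (SOME h. h * (U i - U j) = 1))"

lemma R_inverse:
  assumes "u i \<noteq> u j" shows "R i j * (U i - U j) = 1"
proof -
  have "mfps_nth (U i - U j) 0 \<noteq> 0" using assms by (simp add: u_def)
  then obtain h where "h * (U i - U j) = 1" by (rule mfps_inverse_exists)
  then show ?thesis using assms someI[of "\<lambda>h. h * (U i - U j) = 1"] by (simp add: R_def)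
qed

lemma D_R: "D (R i j) = - (R i j * R i j * (v i - v j))"
proof (cases "u i = u j")
  case True then show ?thesis by (simp add: R_def field_apply_rules)
next
  case False
  have DU: "D (U i) = v i" for i
    using D_v[of i] by (simp add: v_def field_apply_rules)
  have "D (R i j) * (U i - U j) + R i j * (v i - v j) = D (R i j * (U i - U j))"
    by (simp add: field_apply_rules DU)
  then have "D (R i j) * (U i - U j) + R i j * (v i - v j) = 0"
    by (simp add: R_inverse[OF False] field_apply_rules)
  then have "R i j * (D (R i j) * (U i - U j) + R i j * (v i - v j)) = 0" by simp
  then have "D (R i j) * (R i j * (U i - U j)) + R i j * R i j * (v i - v j) = 0"
    by (simp only: distrib_left mult_ac)
  then show ?thesis by (simp add: R_inverse[OF False] eq_neg_iff_add_eq_0)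
qed

lemma D_g_distinct:
  assumes "u i \<noteq> u j"
  shows "D (g i j) = D (R i j) * V i j + R i j * D (V i j)"
proof -
  have ij: "i \<noteq> j" using assms by auto
  then have "R i j * V i j = (R i j * (U i - U j)) * g i j"
    by (simp only: V_offdiag[OF ij] mult.assoc)
  then have "g i j = R i j * V i j" by (simp add: R_inverse[OF assms])
  then show ?thesis by (simp add: field_apply_rules)
qed

definition unknowns :: "(complex, 'n) mfps set" where
  "unknowns = range v \<union> range (case_prod P) \<union> range (case_prod \<Psi>) \<union> range (case_prod V)
    \<union> range (case_prod g) \<union> range (case_prod R)"

lemma finite_unknowns: "finite unknowns"
  by (simp add: unknowns_def)

lemma dominated_unknowns [dom_intros]:
  "dominated unknowns (v i)" "dominated unknowns (P \<alpha> i)" "dominated unknowns (\<Psi> i \<alpha>)"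
  "dominated unknowns (V i j)" "dominated unknowns (g i j)" "dominated unknowns (R i j)"
  by (rule dominated_member; force simp: unknowns_def)+

lemma dominated_w [dom_intros]: "dominated unknowns (w i j)"
  by (auto simp: w_def intro!: dom_intros)

lemma dominated_D_g: "dominated unknowns (D (g i j))"
proof -
  consider "i = j" | "i \<noteq> j" "u i = u j" | "u i \<noteq> u j" by blast
  then show ?thesis
  proof cases
    case 1 then show ?thesis by (simp add: g_def field_apply_rules dom_intros)
  next
    case 2 then show ?thesis unfolding D_g_coalescing[OF 2] by (intro dom_intros)
  next
    case 3 then show ?thesis unfolding D_g_distinct[OF 3] D_R D_V by (intro dom_intros)
  qed
qed

text \<open>All unknowns have polynomial derivatives along \<open>H\<close>, so they converge, and \<open>c\<close> is a polynomial in
  \<open>P\<close> and \<open>\<Psi>\<close>.\<close>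

lemma structure_bounded:
  obtains \<rho> B where "0 < \<rho>" "\<And>M \<alpha> \<beta> \<gamma>. trunc_norm \<rho> M (c \<alpha> \<beta> \<gamma>) \<le> B"
proof -
  have "dominated unknowns (D y)" if "y \<in> unknowns" for y
  proof -
    have "(\<exists>i. y = v i) \<or> (\<exists>\<alpha> i. y = P \<alpha> i) \<or> (\<exists>i \<alpha>. y = \<Psi> i \<alpha>) \<or> (\<exists>i j. y = V i j)
        \<or> (\<exists>i j. y = g i j) \<or> (\<exists>i j. y = R i j)"
      using that by (auto simp: unknowns_def)
    then show ?thesis
      by (auto simp: D_v D_P D_\<Psi> D_V D_R intro!: dom_intros dominated_D_g)
  qed
  moreover have "dominated unknowns (H $ \<alpha>)" for \<alpha>
    by (simp add: H_def dom_intros)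
  ultimately obtain \<rho> B where \<rho>: "0 < \<rho>" "\<rho> \<le> 1/2"
    and B: "\<And>M y. y \<in> unknowns \<Longrightarrow> trunc_norm \<rho> M y \<le> B"
    using bounded_of_dominated_system[OF finite_unknowns H_at_0 H_linear_part] by blast
  have dom: "dominated unknowns (c \<alpha> \<beta> \<gamma>)" for \<alpha> \<beta> \<gamma>
    unfolding structure_eq by (intro dom_intros)
  have "\<exists>G. \<forall>M. trunc_norm \<rho> M (c \<alpha> \<beta> \<gamma>) \<le> G" for \<alpha> \<beta> \<gamma>
    using dom[of \<alpha> \<beta> \<gamma>] \<rho> B unfolding dominated_def by (meson less_imp_le)
  then obtain G where G: "\<And>M \<alpha> \<beta> \<gamma>. trunc_norm \<rho> M (c \<alpha> \<beta> \<gamma>) \<le> G \<alpha> \<beta> \<gamma>" by metis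
  let ?G = "Max (range (\<lambda>(\<alpha>, \<beta>, \<gamma>). G \<alpha> \<beta> \<gamma>))"
  have "G \<alpha> \<beta> \<gamma> \<le> ?G" for \<alpha> \<beta> \<gamma>
    by (rule Max_ge) (auto intro!: image_eqI[of _ _ "(\<alpha>, \<beta>, \<gamma>)"])
  then have "trunc_norm \<rho> M (c \<alpha> \<beta> \<gamma>) \<le> ?G" for M \<alpha> \<beta> \<gamma>
    using G order_trans by blast
  then show thesis using \<rho> that by blast
qed

end

text \<open>Second derivatives remove the inhomogeneous term of degree at most 1; commuting a derivative past the Euler
  field shifts the weight.\<close>

lemma second_derivative_homogeneous:
  fixes F :: "(complex, 'n::finite) mfps ^ 'n"
  assumes "\<forall>\<alpha>. \<exists>p. mfps_poly_degree_le 1 p \<and>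
     field_apply (euler_field q r) (F $ \<alpha>) = mfps_const (2 - q $ \<alpha>) * F $ \<alpha> + p"
  shows "field_apply (euler_field q r) (structure_coeff F \<alpha> \<beta> \<gamma>)
    = mfps_const (q $ \<beta> + q $ \<gamma> - q $ \<alpha>) * structure_coeff F \<alpha> \<beta> \<gamma>"
proof -
  obtain p where p: "mfps_poly_degree_le 1 p"
    and E: "field_apply (euler_field q r) (F $ \<alpha>) = mfps_const (2 - q $ \<alpha>) * F $ \<alpha> + p"
    using assms by blast
  have comm: "mfps_deriv \<beta> (field_apply (euler_field q r) f)
      = mfps_const (1 - q $ \<beta>) * mfps_deriv \<beta> f + field_apply (euler_field q r) (mfps_deriv \<beta> f)" for \<beta> f
  proof -
    have "mfps_deriv \<beta> (euler_field q r $ \<epsilon>) = mfps_const (1 - q $ \<beta>) * (if \<beta> = \<epsilon> then 1 else 0)" for \<epsilon>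
      by (auto simp: euler_field_def mfps_deriv_rules mfps_deriv_var)
    then show ?thesis
      by (simp add: field_apply_def mfps_deriv_rules sum.distrib mfps_deriv_commute[of \<beta>] mult.assoc
            sum_delta_simps flip: sum_distrib_left)
  qed
  have p0: "mfps_deriv \<beta> (mfps_deriv \<gamma> p) = 0"
    using p by (intro mfps_eqI) (simp add: mfps_poly_degree_le_def flip: mdeg_def)
  have "mfps_deriv \<beta> (mfps_deriv \<gamma> (field_apply (euler_field q r) (F $ \<alpha>)))
      = mfps_const (2 - q $ \<alpha>) * mfps_deriv \<beta> (mfps_deriv \<gamma> (F $ \<alpha>))"
    unfolding E by (simp add: mfps_deriv_rules p0)
  moreover have "mfps_const (2 - q $ \<alpha>) = (mfps_const (q $ \<beta> + q $ \<gamma> - q $ \<alpha>)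
      + mfps_const (1 - q $ \<beta>) + mfps_const (1 - q $ \<gamma>) :: (complex, 'n) mfps)"
    by (simp flip: mfps_const_simps(3))
  ultimately show ?thesis
    unfolding comm mfps_deriv_rules structure_coeff_def by (simp add: algebra_simps)
qed

section \<open>From the structure functions to the potential\<close>

text \<open>A coefficient of \<open>f\<close> other than the constant one is, up to division by a positive integer, a coefficient
  of lower degree of one of the partial derivatives. Hence exponential bounds pass from the
  derivatives to \<open>f\<close>.\<close>

lemma coeff_bound_antiderivative:
  fixes f :: "(complex, 'n::finite) mfps"
  assumes R: "1 \<le> R" and B: "\<And>\<beta> m. norm (mfps_nth (mfps_deriv \<beta> f) m) \<le> B * R ^ mdeg m"
  shows "norm (mfps_nth f m) \<le> (B + norm (mfps_nth f 0)) * R ^ mdeg m"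
proof (cases "m = 0")
  case True
  have "0 \<le> B" using B[of undefined 0] norm_ge_zero order_trans by (metis mdeg_zero mult.right_neutral power_0)
  then show ?thesis using True by simp
next
  case False
  then obtain \<beta> where "m $ \<beta> > 0" by (auto simp: vec_eq_iff)
  then obtain l where l: "m = l + axis \<beta> 1" using nonzero_index_split by blast
  have "1 * norm (mfps_nth f m) \<le> real (l $ \<beta> + 1) * norm (mfps_nth f m)"
    by (rule mult_right_mono) auto
  also have "\<dots> = norm (mfps_nth (mfps_deriv \<beta> f) l)"
    by (simp only: mfps_deriv.rep_eq norm_mult l norm_of_nat)
  also have "\<dots> \<le> B * R ^ mdeg l" by (rule B)
  also have "\<dots> \<le> (B + norm (mfps_nth f 0)) * R ^ mdeg m"
  proof (rule mult_mono)
    show "R ^ mdeg l \<le> R ^ mdeg m" using R l by (intro power_increasing) auto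
    have "0 \<le> B" using B[of undefined 0] norm_ge_zero order_trans by (metis mdeg_zero mult.right_neutral power_0)
    then show "0 \<le> B + norm (mfps_nth f 0)" by simp
  qed (use R in auto)
  finally show ?thesis by simp
qed

lemma coeff_bound_of_trunc_norm:
  assumes "0 < \<rho>" and B: "\<And>M. trunc_norm \<rho> M f \<le> B"
  shows "norm (mfps_nth f m) \<le> B * max 1 (1 / \<rho>) ^ mdeg m"
proof -
  let ?R = "max 1 (1 / \<rho>)"
  have B0: "0 \<le> B" using trunc_norm_nonneg[of \<rho> 0 f] B[of 0] assms(1) by linarith
  have "norm_weight \<rho> (mdeg m) * norm (mfps_nth f m) \<le> trunc_norm \<rho> (mdeg m) f"
    unfolding trunc_norm_def using assms
    by (intro member_le_sum[of m _ "\<lambda>m. norm_weight \<rho> (mdeg m) * norm (mfps_nth f m)"]) auto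
  also have "\<dots> \<le> B" by (rule B)
  finally have b: "norm_weight \<rho> (mdeg m) * norm (mfps_nth f m) \<le> B" .
  have "1 \<le> norm_weight \<rho> (mdeg m) * ?R ^ mdeg m"
  proof (cases "mdeg m")
    case (Suc k)
    have "1 * 1 \<le> (\<rho> * ?R) ^ k * ?R"
    proof (rule mult_mono)
      have "\<rho> * (1 / \<rho>) \<le> \<rho> * ?R" using assms(1) by (intro mult_left_mono) auto
      then have "1 \<le> \<rho> * ?R" using assms(1) by simp
      then show "1 \<le> (\<rho> * ?R) ^ k" by (rule one_le_power)
    qed (use assms(1) in auto)
    also have "\<dots> = 1 * ((\<rho> * ?R) ^ k * ?R)" by simp
    also have "\<dots> \<le> real (Suc k) * ((\<rho> * ?R) ^ k * ?R)"
      using assms(1) by (intro mult_right_mono) auto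
    finally show ?thesis by (simp add: Suc norm_weight_def power_mult_distrib mult_ac)
  qed (simp add: norm_weight_def)
  then have "norm (mfps_nth f m) * 1 \<le> norm (mfps_nth f m) * (norm_weight \<rho> (mdeg m) * ?R ^ mdeg m)"
    by (intro mult_left_mono) auto
  also have "\<dots> = (norm_weight \<rho> (mdeg m) * norm (mfps_nth f m)) * ?R ^ mdeg m" by (simp add: mult_ac)
  also have "\<dots> \<le> B * ?R ^ mdeg m" using b by (intro mult_right_mono) auto
  finally show ?thesis by simp
qed

text \<open>Comparison with a product of geometric series of ratio \<open>1/2\<close>.\<close>

lemma converges_of_coeff_bound:
  fixes f :: "(complex, 'n::finite) mfps"
  assumes R: "1 \<le> R" and B: "\<And>m. norm (mfps_nth f m) \<le> B * R ^ mdeg m"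
    and t: "\<And>\<alpha>. norm (t $ \<alpha>) \<le> 1 / (2 * R)"
  shows "mfps_converges_at f t"
proof -
  let ?x = "\<lambda>m. mfps_nth f m * (\<Prod>\<alpha>\<in>UNIV. (t $ \<alpha>) ^ (m $ \<alpha>))"
  have B0: "0 \<le> B" using order_trans[OF norm_ge_zero B[of 0]] by simp
  have le: "norm (?x m) \<le> B * (\<Prod>\<alpha>\<in>UNIV. (1/2) ^ (m $ \<alpha>))" for m
  proof -
    have "(\<Prod>\<alpha>\<in>UNIV. norm (t $ \<alpha>) ^ (m $ \<alpha>)) \<le> (\<Prod>\<alpha>\<in>UNIV. (1 / (2 * R)) ^ (m $ \<alpha>))"
      using t by (intro prod_mono conjI power_mono) auto
    then have "norm (?x m) \<le> (B * R ^ mdeg m) * (\<Prod>\<alpha>\<in>UNIV. (1 / (2 * R)) ^ (m $ \<alpha>))"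
      unfolding norm_mult prod_norm[symmetric] norm_power
      using B R B0 by (intro mult_mono) (auto intro!: prod_nonneg)
    also have "\<dots> = B * (\<Prod>\<alpha>\<in>UNIV. R ^ (m $ \<alpha>) * (1 / (2 * R)) ^ (m $ \<alpha>))"
      by (simp add: mdeg_def power_sum prod.distrib)
    also have "\<dots> = B * (\<Prod>\<alpha>\<in>UNIV. (1/2) ^ (m $ \<alpha>))"
      using R by (simp add: power_mult_distrib[symmetric])
    finally show ?thesis .
  qed
  have "(\<lambda>m. norm (?x m)) summable_on UNIV"
  proof (rule nonneg_bdd_above_summable_on)
    show "bdd_above (sum (\<lambda>m. norm (?x m)) ` {S. S \<subseteq> UNIV \<and> finite S})"
    proof (rule bdd_aboveI2)
      fix S :: "(nat ^ 'n) set" assume "S \<in> {S. S \<subseteq> UNIV \<and> finite S}"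
      then have fin: "finite S" by simp
      define N where "N = (\<Sum>m\<in>S. mdeg m)"
      have N: "m $ \<alpha> \<le> N" if "m \<in> S" for m \<alpha>
        using component_le_mdeg[of m \<alpha>] member_le_sum[of m S mdeg] fin that unfolding N_def by simp
      have "(\<Sum>m\<in>S. norm (?x m)) \<le> (\<Sum>m\<in>S. B * (\<Prod>\<alpha>\<in>UNIV. (1/2) ^ (m $ \<alpha>)))"
        by (intro sum_mono le)
      also have "\<dots> = (\<Sum>h\<in>vec_nth ` S. B * (\<Prod>\<alpha>\<in>UNIV. (1/2) ^ h \<alpha>))"
        by (subst sum.reindex) (auto simp: inj_on_def vec_nth_inject)
      also have "\<dots> \<le> (\<Sum>h\<in>Pi\<^sub>E (UNIV :: 'n set) (\<lambda>_. {..N}). B * (\<Prod>\<alpha>\<in>UNIV. (1/2) ^ h \<alpha>))"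
        using N B0 by (intro sum_mono2 finite_PiE) (auto intro!: mult_nonneg_nonneg prod_nonneg)
      also have "\<dots> = B * (\<Prod>\<alpha>\<in>(UNIV :: 'n set). \<Sum>k\<le>N. (1/2) ^ k)"
        by (subst prod_sum_PiE) (auto simp: sum_distrib_left)
      also have "\<dots> \<le> B * (\<Prod>\<alpha>\<in>(UNIV :: 'n set). 2)"
      proof (intro mult_left_mono prod_mono conjI B0)
        have "(\<Sum>k\<le>N. (1/2 :: real) ^ k) \<le> (\<Sum>k. (1/2) ^ k)"
          by (intro sum_le_suminf summable_geometric) auto
        then show "(\<Sum>k\<le>N. (1/2 :: real) ^ k) \<le> 2" by (simp add: suminf_geometric)
      qed (auto intro: sum_nonneg)
      finally show "(\<Sum>m\<in>S. norm (?x m)) \<le> B * (\<Prod>\<alpha>\<in>(UNIV :: 'n set). 2)" .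
    qed
  qed auto
  then show ?thesis
    unfolding mfps_converges_at_def by (rule abs_summable_summable)
qed


theorem theorem1p3:
  fixes F :: "(complex, 'n::finite) mfps ^ 'n"
    and A q r :: "complex ^ 'n"
  assumes "oriented_associativity A F"
    and "quasi_homogeneous q r F"
    and "semisimple_at_zero F"
    and "\<not> strictly_doubly_resonant q r F"
  shows "mfps_tuple_convergent F"
proof -
  define c where "c = structure_coeff F"
  have unit: "(\<Sum>\<mu>\<in>UNIV. mfps_const (A $ \<mu>) * c \<alpha> \<mu> \<beta>) = (if \<alpha> = \<beta> then 1 else 0)"
    and oriented: "(\<Sum>\<mu>\<in>UNIV. c \<alpha> \<mu> \<beta> * c \<mu> \<gamma> \<epsilon>) = (\<Sum>\<mu>\<in>UNIV. c \<alpha> \<mu> \<gamma> * c \<mu> \<beta> \<epsilon>)"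
    for \<alpha> \<beta> \<gamma> \<epsilon>
    using assms(1) by (simp_all add: oriented_associativity_def c_def)
  have symm: "c \<alpha> \<beta> \<gamma> = c \<alpha> \<gamma> \<beta>" for \<alpha> \<beta> \<gamma>
    by (simp add: c_def structure_coeff_def mfps_deriv_commute)
  have closed: "mfps_deriv \<delta> (c \<alpha> \<beta> \<gamma>) = mfps_deriv \<gamma> (c \<alpha> \<beta> \<delta>)" for \<alpha> \<beta> \<gamma> \<delta>
    by (simp add: c_def structure_coeff_def mfps_deriv_commute)
  have homog: "field_apply (euler_field q r) (c \<alpha> \<beta> \<gamma>) = mfps_const (q $ \<beta> + q $ \<gamma> - q $ \<alpha>) * c \<alpha> \<beta> \<gamma>"
    for \<alpha> \<beta> \<gamma>
    using assms(2) by (auto simp: quasi_homogeneous_def c_def intro: second_derivative_homogeneous)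
  have comm: "alg_mult c x y = alg_mult c y x" for x y by (rule alg_mult_commute[OF symm])
  have assoc: "alg_mult c (alg_mult c x y) z = alg_mult c x (alg_mult c y z)" for x y z
  proof (rule alg_mult_assoc)
    fix \<alpha> \<mu> \<nu> \<gamma>
    have "(\<Sum>\<beta>\<in>UNIV. c \<beta> \<mu> \<nu> * c \<alpha> \<beta> \<gamma>) = (\<Sum>\<beta>\<in>UNIV. c \<alpha> \<beta> \<gamma> * c \<beta> \<mu> \<nu>)"
      by (simp add: mult.commute)
    also have "\<dots> = (\<Sum>\<beta>\<in>UNIV. c \<alpha> \<beta> \<mu> * c \<beta> \<gamma> \<nu>)" by (rule oriented)
    also have "\<dots> = (\<Sum>\<beta>\<in>UNIV. c \<alpha> \<mu> \<beta> * c \<beta> \<nu> \<gamma>)"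
      by (intro sum.cong refl) (simp only: symm[of \<alpha> \<mu>] symm[of _ \<nu> \<gamma>])
    finally show "(\<Sum>\<beta>\<in>UNIV. c \<beta> \<mu> \<nu> * c \<alpha> \<beta> \<gamma>) = (\<Sum>\<beta>\<in>UNIV. c \<alpha> \<mu> \<beta> * c \<beta> \<nu> \<gamma>)" .
  qed
  obtain \<pi> where \<pi>: "idempotent_basis F \<pi>" using assms(3) by (auto simp: semisimple_at_zero_def)
  have "product_at_zero F = alg_mult (\<lambda>\<alpha> \<beta> \<gamma>. mfps_nth (c \<alpha> \<beta> \<gamma>) 0)"
    by (simp add: fun_eq_iff product_at_zero_def alg_mult_def mfps_at_zero_def c_def)
  then have idem: "alg_mult (\<lambda>\<alpha> \<beta> \<gamma>. mfps_nth (c \<alpha> \<beta> \<gamma>) 0) (\<pi> i) (\<pi> j) = (if i = j then \<pi> i else 0)"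
    and span: "vec.span (range \<pi>) = UNIV" for i j
    using \<pi> by (simp_all add: idempotent_basis_def)
  obtain P \<Psi> :: "'n \<Rightarrow> 'n \<Rightarrow> (complex, 'n) mfps"
    where frame: "\<And>i j. (\<Sum>\<alpha>\<in>UNIV. \<Psi> i \<alpha> * P \<alpha> j) = (if i = j then 1 else 0)"
    "\<And>\<alpha> \<beta>. (\<Sum>i\<in>UNIV. P \<alpha> i * \<Psi> i \<beta>) = (if \<alpha> = \<beta> then 1 else 0)"
    "\<And>\<alpha> \<gamma> j. (\<Sum>\<beta>\<in>UNIV. c \<alpha> \<beta> \<gamma> * P \<beta> j) = \<Psi> j \<gamma> * P \<alpha> j"
    by (rule formal_idempotent_frame[OF comm assoc idem span]) (rule that)
  interpret semisimple_frame c P \<Psi> A q r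
    by unfold_locales (fact frame unit closed homog)+
  obtain \<rho> B where \<rho>: "0 < \<rho>" and B: "\<And>M \<alpha> \<beta> \<gamma>. trunc_norm \<rho> M (c \<alpha> \<beta> \<gamma>) \<le> B"
    by (rule structure_bounded) (rule that)
  define R where "R = max 1 (1 / \<rho>)"
  have R: "1 \<le> R" by (simp add: R_def)
  have "norm (mfps_nth (mfps_deriv \<beta> (mfps_deriv \<gamma> (F $ \<alpha>))) m) \<le> B * R ^ mdeg m" for \<alpha> \<beta> \<gamma> m
    using coeff_bound_of_trunc_norm[OF \<rho> B[of _ \<alpha> \<beta> \<gamma>], of m] unfolding R_def c_def structure_coeff_def .
  then have d1: "norm (mfps_nth (mfps_deriv \<gamma> (F $ \<alpha>)) m)
      \<le> (B + norm (mfps_nth (mfps_deriv \<gamma> (F $ \<alpha>)) 0)) * R ^ mdeg m" for \<alpha> \<gamma> m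
    by (rule coeff_bound_antiderivative[OF R])
  define B1 where "B1 = B + (\<Sum>\<alpha>\<in>UNIV. \<Sum>\<gamma>\<in>UNIV. norm (mfps_nth (mfps_deriv \<gamma> (F $ \<alpha>)) 0))"
  have B1: "B + norm (mfps_nth (mfps_deriv \<gamma> (F $ \<alpha>)) 0) \<le> B1" for \<alpha> \<gamma>
  proof -
    have "norm (mfps_nth (mfps_deriv \<gamma> (F $ \<alpha>)) 0) \<le> (\<Sum>\<gamma>\<in>UNIV. norm (mfps_nth (mfps_deriv \<gamma> (F $ \<alpha>)) 0))"
      by (rule member_le_sum) auto
    also have "\<dots> \<le> (\<Sum>\<alpha>\<in>UNIV. \<Sum>\<gamma>\<in>UNIV. norm (mfps_nth (mfps_deriv \<gamma> (F $ \<alpha>)) 0))"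
      by (rule member_le_sum[of \<alpha> UNIV "\<lambda>\<alpha>. \<Sum>\<gamma>\<in>UNIV. norm (mfps_nth (mfps_deriv \<gamma> (F $ \<alpha>)) 0)"]) (auto intro!: sum_nonneg)
    finally show ?thesis by (simp add: B1_def)
  qed
  have "norm (mfps_nth (mfps_deriv \<gamma> (F $ \<alpha>)) m) \<le> B1 * R ^ mdeg m" for \<alpha> \<gamma> m
    using R by (intro order_trans[OF d1] mult_right_mono B1) auto
  then have "norm (mfps_nth (F $ \<alpha>) m) \<le> (B1 + norm (mfps_nth (F $ \<alpha>) 0)) * R ^ mdeg m" for \<alpha> m
    by (rule coeff_bound_antiderivative[OF R])
  then have conv: "mfps_converges_at (F $ \<alpha>) t" if "\<And>\<alpha>. norm (t $ \<alpha>) \<le> 1 / (2 * R)" for \<alpha> t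
    using converges_of_coeff_bound[OF R] that by blast
  show ?thesis
    unfolding mfps_tuple_convergent_def
  proof (intro exI[of _ "ball 0 (1 / (2 * R))"] conjI ballI allI conv)
    show "0 \<in> ball 0 (1 / (2 * R))" using R by simp
  next
    fix t :: "complex ^ 'n" and \<beta> assume "t \<in> ball 0 (1 / (2 * R))"
    then show "norm (t $ \<beta>) \<le> 1 / (2 * R)"
      using order_trans[OF Finite_Cartesian_Product.norm_nth_le, of t "1 / (2 * R)" \<beta>] by simp
  qed simp
qed

end
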